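(* Let $$U(w)\equiv U(t;w)=\frac{1-tw+t^2+t^3w-\sqrt{(1-t^2)(1+t-tw+t^2w)(1-t-tw-t^2w)}}{2t},$$ which is the only power series in $t$ satisfying $(U-t)(1-tU)=twU(1-t^2)$, and let $$q\equiv q(t)=U(t;1)=\frac{1-t+t^2+t^3-\sqrt{(1-t^4)(1-2t-t^2)}}{2t}.$$ Then the generating function $T(t;u,v)$ of $3$-sided walks ending on the top of their box satisfies $$T(t;u,tu)=\sum_{k\ge 0}(-1)^k\,\frac{\prod_{i=0}^{k-1}\left(\frac{t}{1-tq}-U(uq^{i+1})\right)}{\prod_{i=0}^{k}\left(\frac{tq}{q-t}-U(uq^{i})\right)}\left(1+\frac{U(uq^k)-t}{t(1-tU(uq^k))}+\frac{U(uq^{k+1})-t}{t(1-tU(uq^{k+1}))}\right).$$ The generating function $P(t;u)$ of $3$-sided walks, counted by their length and by the width of the box, can be expressed rationally in terms of $U(u)$ and $T(t;u,tu)$, namely $$P(t;u)=\frac{1}{1-2t-t^2}\left(2t^2U(u)T(t;u,tu)+\frac{(1+t)(2-t-t^2U(u))}{1-tU(u)}\right)-\frac{2(1-U(u))(1+t)(1-u)}{(1-2t-t^2)(1-t-tu-t^2u)}\left(t^2T(t;u,tu)+\frac{(1+t)t}{1-tU(u)}\right)-\frac{1}{1-t}.$$ When $u=1$, this gives the length generating function as $$P(t;1)=\frac{1}{1-2t-t^2}\left(2t^2q\,T(t;1,t)+\frac{(1+t)(2-t-t^2q)}{1-tq}\right)-\frac{1}{1-t}.$$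
   Context: Walks on the square lattice start at the origin and take unit steps N, E, S, W. A walk is prudent if it never takes a step pointing towards a vertex it has already visited (a step from $p$ in direction $d$ is forbidden if some $p+kd$, $k\ge1$, has already been visited). The box of a walk is the smallest (axis-parallel, possibly degenerate) rectangle containing it. A prudent walk is $3$-sided if, as the walk grows, its endpoint always lies on the top, right or left edge of the box of the walk constructed so far; this is also required at non-integral points, i.e. when the walk is viewed as a continuous process (so that, for example, the walk ESW is not $3$-sided). $T(t;u,v)=\sum t^{n}u^{i}v^{j}$, where the sum is over all $3$-sided walks whose endpoint is on the top edge of their box, $n$ is the length, $i$ is the distance from the endpoint to the north-east corner of the box and $j$ the distance from the endpoint to the north-west corner. $P(t;u)=\sum t^n u^{m}$ over all $3$-sided walks, where $n$ is the length and $m$ is the width (horizontal side length) of the box. All these series are power series in $t$ whose coefficients are polynomials in the other variables. $U(x)$ denotes $U(t;x)$. The empty walk is included. *)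

theory Defs
  imports "HOL-Computational_Algebra.Formal_Power_Series"
begin

datatype step = North | East | South | West

fun dx :: "step \<Rightarrow> int" where
  "dx East = 1" | "dx West = -1" | "dx North = 0" | "dx South = 0"

fun dy :: "step \<Rightarrow> int" where
  "dy North = 1" | "dy South = -1" | "dy East = 0" | "dy West = 0"

text \<open>A walk is the list of its steps; it starts at the origin.\<close>

definition endpoint :: "step list \<Rightarrow> int \<times> int" where
  "endpoint w = ((\<Sum>s\<leftarrow>w. dx s), (\<Sum>s\<leftarrow>w. dy s))"

definition visited :: "step list \<Rightarrow> (int \<times> int) set" where
  "visited w = (\<lambda>n. endpoint (take n w)) ` {..length w}"

definition prudent :: "step list \<Rightarrow> bool" where
  "prudent w \<longleftrightarrow>
     (\<forall>n<length w. \<forall>k::int. k \<ge> 1 \<longrightarrow>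
        (fst (endpoint (take n w)) + k * dx (w ! n),
         snd (endpoint (take n w)) + k * dy (w ! n)) \<notin> visited (take n w))"

text \<open>The box of a walk is \<open>[box_left w, box_right w] \<times> [box_bottom w, box_top w]\<close>.\<close>

definition box_left :: "step list \<Rightarrow> int" where "box_left w = Min (fst ` visited w)"
definition box_right :: "step list \<Rightarrow> int" where "box_right w = Max (fst ` visited w)"
definition box_bottom :: "step list \<Rightarrow> int" where "box_bottom w = Min (snd ` visited w)"
definition box_top :: "step list \<Rightarrow> int" where "box_top w = Max (snd ` visited w)"

text \<open>The walk as a continuous process: at time \<open>\<tau> \<in> [0, length w]\<close> the \<open>i\<close>-th step
  (counted from \<open>0\<close>) has been completed up to the fraction \<open>\<tau> - i\<close>, clamped to \<open>[0, 1]\<close>.\<close>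

definition pos_x :: "step list \<Rightarrow> real \<Rightarrow> real" where
  "pos_x w \<tau> = (\<Sum>i<length w. max 0 (min 1 (\<tau> - real i)) * of_int (dx (w ! i)))"

definition pos_y :: "step list \<Rightarrow> real \<Rightarrow> real" where
  "pos_y w \<tau> = (\<Sum>i<length w. max 0 (min 1 (\<tau> - real i)) * of_int (dy (w ! i)))"

text \<open>The current point always lies in the box of the trajectory over \<open>[0, \<tau>]\<close>, so it is on the
  top (right, left) edge iff its ordinate (abscissa) is the extreme one.\<close>

definition three_sided :: "step list \<Rightarrow> bool" where
  "three_sided w \<longleftrightarrow> prudent w \<and>
     (\<forall>\<tau>\<in>{0..real (length w)}.
        pos_y w \<tau> = (SUP \<sigma>\<in>{0..\<tau>}. pos_y w \<sigma>) \<or>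
        pos_x w \<tau> = (SUP \<sigma>\<in>{0..\<tau>}. pos_x w \<sigma>) \<or>
        pos_x w \<tau> = (INF \<sigma>\<in>{0..\<tau>}. pos_x w \<sigma>))"

definition ends_on_top :: "step list \<Rightarrow> bool" where
  "ends_on_top w \<longleftrightarrow> snd (endpoint w) = box_top w"

text \<open>For a walk ending on the top edge of its box these are the distances from the endpoint to
  the north-east and north-west corners.\<close>

definition dist_NE :: "step list \<Rightarrow> nat" where
  "dist_NE w = nat (box_right w - fst (endpoint w))"

definition dist_NW :: "step list \<Rightarrow> nat" where
  "dist_NW w = nat (fst (endpoint w) - box_left w)"

definition box_width :: "step list \<Rightarrow> nat" where
  "box_width w = nat (box_right w - box_left w)"

text \<open>
  The length variable \<open>t\<close> is \<open>fps_X\<close>. A series in \<open>t\<close> with coefficients polynomial in further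
  variables is represented by the function that substitutes arbitrary series in \<open>t\<close> over a field
  of characteristic \<open>0\<close> for those variables, as is needed for instances such as \<open>T(t; u, tu)\<close> and
  \<open>U(t; u q\<^sup>i)\<close>. The case of an indeterminate \<open>u\<close> is included: take the field to be the rational
  functions in \<open>u\<close>, and the substituted series to be the constant series \<open>u\<close>. Infinite sums are
  taken in the \<open>t\<close>-adic topology of the type \<open>fps\<close>; those below converge since the \<open>n\<close>-th term is
  divisible by \<open>t\<^sup>n\<close>.
\<close>

definition T_gf :: "'a::field_char_0 fps \<Rightarrow> 'a fps \<Rightarrow> 'a fps" where
  "T_gf u v =
     (\<Sum>n. fps_X ^ n *
        (\<Sum>w | length w = n \<and> three_sided w \<and> ends_on_top w. u ^ dist_NE w * v ^ dist_NW w))"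

definition P_gf :: "'a::field_char_0 fps \<Rightarrow> 'a fps" where
  "P_gf u = (\<Sum>n. fps_X ^ n * (\<Sum>w | length w = n \<and> three_sided w. u ^ box_width w))"

text \<open>The square root with constant coefficient \<open>1\<close>, for series with constant coefficient \<open>1\<close>:
  the first argument of \<open>fps_radical\<close> selects the root of the constant coefficient.\<close>

definition fps_sqrt1 :: "'a::field_char_0 fps \<Rightarrow> 'a fps" where
  "fps_sqrt1 = fps_radical (\<lambda>_ _. 1) 2"

text \<open>The numerator below has constant coefficient \<open>0\<close>, so the division by \<open>2 * t\<close> is exact.\<close>

definition U_ser :: "'a::field_char_0 fps \<Rightarrow> 'a fps" where
  "U_ser w =
     (let t = fps_X in
      (1 - t * w + t^2 + t^3 * w
        - fps_sqrt1 ((1 - t^2) * (1 + t - t * w + t^2 * w) * (1 - t - t * w - t^2 * w)))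
      / (2 * t))"

definition q_ser :: "'a::field_char_0 fps" where
  "q_ser = U_ser 1"

end

theory Submission
  imports Defs
begin

text \<open>A walk is grown one step at a time. Which steps keep it three-sided depends on very little
of its past: on the position of the endpoint relative to the box and on whether the last steps
came from below, from above, from the east or from the west. This is recorded in a \<open>state\<close>, and
the three-sided walks correspond one to one to the paths of an automaton on states
(\<open>three_sided_iff_run\<close>).

Let \<open>L F\<close> (\<open>path_gf F\<close> below) be the sum of \<open>t\<^sup>n F s\<close> over all three-sided walks, where \<open>n\<close> is
the length and \<open>s\<close> the final state. It is linear in \<open>F\<close>, and cutting off the last step shows
that \<open>L (F - t \<Delta>F) = F start\<close>, where \<open>\<Delta>F\<close> sums \<open>F\<close> over the successors of a state
(\<open>path_gf_potential\<close>). Hence every function \<open>F\<close>, read as a potential, yields an equation between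
generating functions, and an equation is proved by checking an identity in each state. The
potentials are chosen so that \<open>F - t \<Delta>F\<close> vanishes except in the states that the equation is
about.

Along a vertical side of the box the potential \<open>z\<^sup>h\<close> in the depth \<open>h\<close> below the top row is of
this kind if \<open>(z - t)(1 - tz) = tvz(1 - t\<^sup>2)\<close>, that is, if \<open>z = U(v)\<close>; here \<open>v\<close> marks the width.
This is the kernel of the side, and it gives the walks that end at a corner in terms of \<open>\<Phi>(v) =
T(v, tv)\<close> (\<open>path_gf_corner\<close>, \<open>corner_gf\<close>). Along the top row the same idea gives an equation for
\<open>T(u, v)\<close> with kernel \<open>1 - uvt(1 - t\<^sup>2) / ((u - tv)(v - tu))\<close>, which vanishes for \<open>v = uq\<close>.
There the equation becomes a relation between \<open>\<Phi>(u)\<close> and \<open>\<Phi>(uq)\<close> (\<open>kernel_step\<close>). Its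
coefficient at \<open>\<Phi>(uq)\<close> is divisible by \<open>t\<close>, so that it can be iterated to the series for \<open>\<Phi>(u)\<close>
(\<open>iterate_to_sums\<close>). The walks counted by width are those ending on top, counted by \<open>T(u, u)\<close>,
and those ending lower on a side, for which the potential that is constant in \<open>h\<close> suffices
(\<open>path_gf_flank\<close>, \<open>width_gf\<close>).

An arbitrary series may be substituted for \<open>u\<close>, in particular \<open>0\<close>; therefore the factors \<open>u -
tv\<close> and \<open>v - tu\<close>, which are multiples of \<open>u\<close> for \<open>v = uq\<close>, never appear as denominators.\<close>

unbundle fps_syntax

section \<open>From the continuous process to single steps\<close>

lemma endpoint_snoc:
  "endpoint (w @ [s]) = (fst (endpoint w) + dx s, snd (endpoint w) + dy s)"
  by (simp add: endpoint_def)

lemma visited_snoc: "visited (w @ [s]) = insert (endpoint (w @ [s])) (visited w)"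
proof -
  have "endpoint (take n (w @ [s])) = endpoint (take n w)" if "n \<le> length w" for n
    using that by simp
  thus ?thesis
    by (auto simp: visited_def atMost_Suc image_iff)
qed

lemma visited_Nil: "visited [] = {(0, 0)}"
  by (simp add: visited_def endpoint_def)

lemma finite_visited: "finite (visited w)"
  by (simp add: visited_def)

definition unobstructed :: "(int \<times> int) set \<Rightarrow> int \<Rightarrow> int \<Rightarrow> step \<Rightarrow> bool" where
  "unobstructed V x y s \<longleftrightarrow> (\<forall>k\<ge>1. (x + k * dx s, y + k * dy s) \<notin> V)"

lemma prudent_snoc:
  "prudent (w @ [s]) \<longleftrightarrow>
     prudent w \<and> unobstructed (visited w) (fst (endpoint w)) (snd (endpoint w)) s"
  by (auto simp: prudent_def unobstructed_def less_Suc_eq nth_append)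

text \<open>One coordinate of the continuous process. With \<open>d = dx\<close>, \<open>dy\<close> and \<open>- dx\<close>, being on the
right, top or left edge of the current box all become the same condition \<open>at_max d\<close>.\<close>

definition coord :: "(step \<Rightarrow> int) \<Rightarrow> step list \<Rightarrow> real \<Rightarrow> real" where
  "coord d w \<tau> = (\<Sum>i<length w. max 0 (min 1 (\<tau> - real i)) * of_int (d (w ! i)))"

definition at_max :: "(step \<Rightarrow> int) \<Rightarrow> step list \<Rightarrow> real \<Rightarrow> bool" where
  "at_max d w \<tau> \<longleftrightarrow> (\<forall>\<sigma>\<in>{0..\<tau>}. coord d w \<sigma> \<le> coord d w \<tau>)"

lemma coord_bounded:
  assumes "\<And>s. \<bar>d s\<bar> \<le> 1"
  shows "\<bar>coord d w \<tau>\<bar> \<le> real (length w)"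
proof -
  have "\<bar>coord d w \<tau>\<bar> \<le> (\<Sum>i<length w. \<bar>max 0 (min 1 (\<tau> - real i)) * real_of_int (d (w ! i))\<bar>)"
    unfolding coord_def by (rule sum_abs)
  also have "\<dots> \<le> (\<Sum>i<length w. 1)"
  proof (rule sum_mono)
    fix i
    have "\<bar>real_of_int (d (w ! i))\<bar> \<le> 1"
      using assms [of "w ! i"] by linarith
    thus "\<bar>max 0 (min 1 (\<tau> - real i)) * real_of_int (d (w ! i))\<bar> \<le> 1"
      unfolding abs_mult by (intro mult_le_one) auto
  qed
  finally show ?thesis by simp
qed

lemma coord_eq_SUP_iff:
  assumes "\<And>s. \<bar>d s\<bar> \<le> 1" "0 \<le> \<tau>"
  shows "coord d w \<tau> = (SUP \<sigma>\<in>{0..\<tau>}. coord d w \<sigma>) \<longleftrightarrow> at_max d w \<tau>"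
proof
  have "bdd_above (coord d w ` {0..\<tau>})"
    using coord_bounded [of d w, OF assms(1)] by (intro bdd_aboveI [of _ "real (length w)"]) (auto simp: abs_le_iff)
  thus "at_max d w \<tau>" if "coord d w \<tau> = (SUP \<sigma>\<in>{0..\<tau>}. coord d w \<sigma>)"
    unfolding at_max_def that by (auto intro: cSUP_upper)
next
  assume "at_max d w \<tau>"
  thus "coord d w \<tau> = (SUP \<sigma>\<in>{0..\<tau>}. coord d w \<sigma>)"
    using \<open>0 \<le> \<tau>\<close> by (intro cSup_eq_maximum [symmetric]) (auto simp: at_max_def)
qed

lemma coord_uminus: "coord (\<lambda>s. - d s) w \<tau> = - coord d w \<tau>"
  by (simp add: coord_def sum_negf)

lemma coord_eq_INF_iff:
  assumes "\<And>s. \<bar>d s\<bar> \<le> 1" "0 \<le> \<tau>"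
  shows "coord d w \<tau> = (INF \<sigma>\<in>{0..\<tau>}. coord d w \<sigma>) \<longleftrightarrow> at_max (\<lambda>s. - d s) w \<tau>"
proof -
  have "coord d w \<tau> = (INF \<sigma>\<in>{0..\<tau>}. coord d w \<sigma>)
    \<longleftrightarrow> coord (\<lambda>s. - d s) w \<tau> = (SUP \<sigma>\<in>{0..\<tau>}. coord (\<lambda>s. - d s) w \<sigma>)"
    by (simp add: Inf_real_def coord_uminus image_image minus_equation_iff equation_minus_iff)
       (metis minus_minus)
  thus ?thesis
    using coord_eq_SUP_iff [of "\<lambda>s. - d s" \<tau> w] assms by simp
qed

lemma abs_dx_le: "\<bar>dx s\<bar> \<le> 1" and abs_dy_le: "\<bar>dy s\<bar> \<le> 1"
  by (cases s; simp)+

lemma three_sided_iff_at_max: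
  "three_sided w \<longleftrightarrow> prudent w \<and> (\<forall>\<tau>\<in>{0..real (length w)}.
     at_max dy w \<tau> \<or> at_max dx w \<tau> \<or> at_max (\<lambda>s. - dx s) w \<tau>)"
proof -
  have "pos_x w = coord dx w" "pos_y w = coord dy w"
    by (simp_all add: fun_eq_iff pos_x_def pos_y_def coord_def)
  thus ?thesis
    by (auto simp: three_sided_def coord_eq_SUP_iff coord_eq_INF_iff abs_dx_le abs_dy_le)
qed

lemma coord_snoc_before:
  assumes "\<tau> \<le> real (length w)"
  shows "coord d (w @ [s]) \<tau> = coord d w \<tau>"
  using assms by (simp add: coord_def nth_append)

lemma coord_end: 
  assumes "real (length w) \<le> \<tau>"
  shows "coord d w \<tau> = of_int (\<Sum>s\<leftarrow>w. d s)"
proof -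
  have "coord d w \<tau> = (\<Sum>i<length w. real_of_int (d (w ! i)))"
    unfolding coord_def using assms by (intro sum.cong) auto
  thus ?thesis by (simp add: sum_list_sum_nth lessThan_atLeast0)
qed

lemma coord_snoc_last:
  assumes "0 \<le> f" "f \<le> 1"
  shows "coord d (w @ [s]) (real (length w) + f) = of_int (\<Sum>s\<leftarrow>w. d s) + f * of_int (d s)"
proof -
  have "coord d (w @ [s]) (real (length w) + f)
      = coord d w (real (length w) + f) + f * of_int (d s)"
    using assms by (simp add: coord_def nth_append)
  thus ?thesis using coord_end [of w "real (length w) + f" d] assms by simp
qed

lemma at_max_snoc_before:
  assumes "\<tau> \<le> real (length w)"
  shows "at_max d (w @ [s]) \<tau> \<longleftrightarrow> at_max d w \<tau>"
  using assms by (auto simp: at_max_def coord_snoc_before)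

text \<open>The coordinate is an affine function of time during each step, so that an upper bound at
the integral times is an upper bound throughout.\<close>

lemma coord_le_iff:
  "(\<forall>\<sigma>\<in>{0..real (length w)}. coord d w \<sigma> \<le> c)
     \<longleftrightarrow> (\<forall>n\<le>length w. of_int (\<Sum>s\<leftarrow>take n w. d s) \<le> c)"
proof (induction w rule: rev_induct)
  case Nil
  show ?case by (simp add: coord_def)
next
  case (snoc s w)
  have "(\<forall>\<sigma>\<in>{0..real (length (w @ [s]))}. coord d (w @ [s]) \<sigma> \<le> c)
      \<longleftrightarrow> (\<forall>\<sigma>\<in>{0..real (length w)}. coord d w \<sigma> \<le> c)
        \<and> (\<forall>f\<in>{0..1}. coord d (w @ [s]) (real (length w) + f) \<le> c)" (is "?A \<longleftrightarrow> ?B \<and> ?C")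
  proof
    assume ?A
    have "coord d w \<sigma> = coord d (w @ [s]) \<sigma>" if "\<sigma> \<le> real (length w)" for \<sigma>
      using that by (rule coord_snoc_before [symmetric])
    hence ?B using \<open>?A\<close> by simp
    thus "?B \<and> ?C" using \<open>?A\<close> by simp
  next
    assume BC: "?B \<and> ?C"
    show ?A
    proof
      fix \<sigma> assume \<sigma>: "\<sigma> \<in> {0..real (length (w @ [s]))}"
      show "coord d (w @ [s]) \<sigma> \<le> c"
      proof (cases "\<sigma> \<le> real (length w)")
        case True
        thus ?thesis using BC \<sigma> by (simp add: coord_snoc_before)
      next
        case False
        hence "\<sigma> - real (length w) \<in> {0..1}" using \<sigma> by simp
        with BC have "coord d (w @ [s]) (real (length w) + (\<sigma> - real (length w))) \<le> c" by blast
        thus ?thesis by simp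
      qed
    qed
  qed
  also have "?C \<longleftrightarrow> of_int (\<Sum>s\<leftarrow>w. d s) \<le> c \<and> of_int (\<Sum>s\<leftarrow>w @ [s]. d s) \<le> c" (is "_ \<longleftrightarrow> ?D \<le> c \<and> ?E \<le> c")
  proof
    assume ?C
    from bspec [OF this, of 0] bspec [OF this, of 1]
    show "?D \<le> c \<and> ?E \<le> c"
      using coord_snoc_last [of 0 d w s] coord_snoc_last [of 1 d w s] by simp
  next
    assume DE: "?D \<le> c \<and> ?E \<le> c"
    show ?C
    proof
      fix f :: real assume f: "f \<in> {0..1}"
      have "(1 - f) * ?D + f * ?E \<le> c"
        using f DE by (intro convex_bound_le) auto
      thus "coord d (w @ [s]) (real (length w) + f) \<le> c"
        using f coord_snoc_last [of f d w s] by (simp add: algebra_simps)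
    qed
  qed
  also have "?B \<and> ?D \<le> c \<and> ?E \<le> c \<longleftrightarrow> (\<forall>n\<le>length (w @ [s]). of_int (\<Sum>s\<leftarrow>take n (w @ [s]). d s) \<le> c)"
    unfolding snoc.IH by (auto simp: le_Suc_eq)
  finally show ?case .
qed

lemma at_max_snoc_last:
  assumes f: "0 < f" "f \<le> 1"
  shows "at_max d (w @ [s]) (real (length w) + f) \<longleftrightarrow>
    (\<forall>n\<le>length w. real_of_int (\<Sum>s\<leftarrow>take n w. d s) \<le> of_int (\<Sum>s\<leftarrow>w. d s) + f * of_int (d s))"
    (is "?L \<longleftrightarrow> ?R")
proof -
  let ?c = "real_of_int (\<Sum>s\<leftarrow>w. d s) + f * of_int (d s)"
  have c: "coord d (w @ [s]) (real (length w) + f) = ?c"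
    using f by (simp add: coord_snoc_last)
  have R: "?R \<longleftrightarrow> (\<forall>\<sigma>\<in>{0..real (length w)}. coord d w \<sigma> \<le> ?c)"
    by (rule coord_le_iff [symmetric])
  show ?thesis
  proof
    assume L: ?L
    show ?R unfolding R
    proof
      fix \<sigma> assume \<sigma>: "\<sigma> \<in> {0..real (length w)}"
      hence "\<sigma> \<in> {0..real (length w) + f}" using f by simp
      with L have "coord d (w @ [s]) \<sigma> \<le> ?c" unfolding at_max_def c by blast
      thus "coord d w \<sigma> \<le> ?c"
        using \<sigma> by (simp add: coord_snoc_before)
    qed
  next
    assume R': ?R
    hence "0 \<le> f * of_int (d s)" by auto
    hence ds: "0 \<le> d s" using f by (simp add: zero_le_mult_iff)
    show ?L unfolding at_max_def c
    proof
      fix \<sigma> assume \<sigma>: "\<sigma> \<in> {0..real (length w) + f}"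
      show "coord d (w @ [s]) \<sigma> \<le> ?c"
      proof (cases "\<sigma> \<le> real (length w)")
        case True
        thus ?thesis using R' \<sigma> unfolding R by (simp add: coord_snoc_before)
      next
        case False
        hence "(\<sigma> - real (length w)) * of_int (d s) \<le> f * of_int (d s)"
          using \<sigma> ds by (intro mult_right_mono) auto
        thus ?thesis using False \<sigma> f coord_snoc_last [of "\<sigma> - real (length w)" d w s] by simp
      qed
    qed
  qed
qed

text \<open>The step \<open>s\<close> runs along, or outwards from, the edge in direction \<open>d\<close> on which the walk \<open>w\<close>
ends.\<close>

definition edge_step :: "(step \<Rightarrow> int) \<Rightarrow> step list \<Rightarrow> step \<Rightarrow> bool" where
  "edge_step d w s \<longleftrightarrow> 0 \<le> d s \<and> (\<forall>n\<le>length w. (\<Sum>s\<leftarrow>take n w. d s) \<le> (\<Sum>s\<leftarrow>w. d s))"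

lemma edge_step_imp_at_max:
  assumes "edge_step d w s" "0 < f" "f \<le> 1"
  shows "at_max d (w @ [s]) (real (length w) + f)"
proof -
  have "0 \<le> f * real_of_int (d s)"
    using assms by (simp add: edge_step_def)
  moreover have "real_of_int (\<Sum>s\<leftarrow>take n w. d s) \<le> real_of_int (\<Sum>s\<leftarrow>w. d s)" if "n \<le> length w" for n
    using assms(1) that unfolding edge_step_def of_int_le_iff by blast
  ultimately show ?thesis
    unfolding at_max_snoc_last [OF assms(2,3)] by (smt (verit))
qed

lemma at_max_imp_edge_step:
  assumes "at_max d (w @ [s]) (real (length w) + 1 / 2)" and d: "\<bar>d s\<bar> \<le> 1"
  shows "edge_step d w s"
proof -
  have *: "real_of_int (\<Sum>s\<leftarrow>take n w. d s) \<le> of_int (\<Sum>s\<leftarrow>w. d s) + 1 / 2 * of_int (d s)"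
    if "n \<le> length w" for n
    using assms(1) that by (subst (asm) at_max_snoc_last) auto
  show ?thesis
    unfolding edge_step_def
  proof (intro conjI allI impI)
    show "0 \<le> d s" using * [of "length w"] by simp
    fix n assume "n \<le> length w"
    from * [OF this] d show "(\<Sum>s\<leftarrow>take n w. d s) \<le> (\<Sum>s\<leftarrow>w. d s)" by linarith
  qed
qed

definition legal :: "(int \<times> int) set \<Rightarrow> int \<Rightarrow> int \<Rightarrow> step \<Rightarrow> bool" where
  "legal V x y s \<longleftrightarrow> unobstructed V x y s \<and>
     ((0 \<le> dy s \<and> (\<forall>x' y'. (x', y') \<in> V \<longrightarrow> y' \<le> y)) \<or>
      (0 \<le> dx s \<and> (\<forall>x' y'. (x', y') \<in> V \<longrightarrow> x' \<le> x)) \<or>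
      (dx s \<le> 0 \<and> (\<forall>x' y'. (x', y') \<in> V \<longrightarrow> x \<le> x')))"

lemma three_sided_Nil: "three_sided []"
  by (simp add: three_sided_def prudent_def pos_x_def pos_y_def)

text \<open>During the last step the edge condition need not hold for the same edge at all times, but
the choice of the edge can be made independent of time: halfway through the step the coordinates
differ from those at its beginning by at most \<open>1/2\<close>, so that, being integers, the earlier ones
are bounded by the coordinate at the beginning.\<close>

lemma three_sided_snoc:
  "three_sided (w @ [s]) \<longleftrightarrow>
     three_sided w \<and> legal (visited w) (fst (endpoint w)) (snd (endpoint w)) s"
proof -
  define A where "A = (\<lambda>w \<tau>. at_max dy w \<tau> \<or> at_max dx w \<tau> \<or> at_max (\<lambda>s. - dx s) w \<tau>)"
  define B where "B \<longleftrightarrow> edge_step dy w s \<or> edge_step dx w s \<or> edge_step (\<lambda>s. - dx s) w s"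
  have before: "A (w @ [s]) \<tau> \<longleftrightarrow> A w \<tau>" if "\<tau> \<le> real (length w)" for \<tau>
    using that by (simp add: A_def at_max_snoc_before)
  have "(\<forall>\<tau>\<in>{0..real (length (w @ [s]))}. A (w @ [s]) \<tau>) \<longleftrightarrow> (\<forall>\<tau>\<in>{0..real (length w)}. A w \<tau>) \<and> B"
  proof (intro iffI conjI ballI)
    assume L: "\<forall>\<tau>\<in>{0..real (length (w @ [s]))}. A (w @ [s]) \<tau>"
    show "A w \<tau>" if \<tau>: "\<tau> \<in> {0..real (length w)}" for \<tau>
    proof -
      have "\<tau> \<in> {0..real (length (w @ [s]))}" using \<tau> by simp
      with L have "A (w @ [s]) \<tau>" by blast
      thus ?thesis using \<tau> before by simp
    qed
    \<comment> \<open>Any time strictly between the two integral times decides which edge the step follows.\<close>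
    have "A (w @ [s]) (real (length w) + 1 / 2)"
      using L by (rule bspec) simp
    thus B
      unfolding A_def B_def using at_max_imp_edge_step abs_dx_le abs_dy_le by fastforce
  next
    fix \<tau> assume R: "(\<forall>\<tau>\<in>{0..real (length w)}. A w \<tau>) \<and> B" and \<tau>: "\<tau> \<in> {0..real (length (w @ [s]))}"
    show "A (w @ [s]) \<tau>"
    proof (cases "\<tau> \<le> real (length w)")
      case True
      thus ?thesis using R \<tau> before by auto
    next
      case False
      thus ?thesis
        using R \<tau> edge_step_imp_at_max [of _ w s "\<tau> - real (length w)"]
        unfolding A_def B_def by auto
    qed
  qed
  moreover have "(\<Sum>s\<leftarrow>v. - dx s) = - (\<Sum>s\<leftarrow>v. dx s)" for v
    by (induction v) simp_all
  hence "B \<longleftrightarrow> (0 \<le> dy s \<and> (\<forall>x' y'. (x', y') \<in> visited w \<longrightarrow> y' \<le> snd (endpoint w))) \<or>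
      (0 \<le> dx s \<and> (\<forall>x' y'. (x', y') \<in> visited w \<longrightarrow> x' \<le> fst (endpoint w))) \<or>
      (dx s \<le> 0 \<and> (\<forall>x' y'. (x', y') \<in> visited w \<longrightarrow> fst (endpoint w) \<le> x'))"
    by (auto simp: B_def edge_step_def visited_def endpoint_def)
  ultimately show ?thesis
    unfolding three_sided_iff_at_max legal_def prudent_snoc A_def by blast
qed

section \<open>The states of a growing walk\<close>

text \<open>How a walk that ends on the right or left side of its box got there: by an outward step
that enlarged the box, or by moving up or down along that side.\<close>

datatype phase = Outward | Upward | Downward

text \<open>The flag \<open>b\<close> is true for the east and false for the west.
\<^item> \<open>Column h\<close>: \<open>h\<close> steps south from the origin, and nothing else. The walk starts in \<open>Column 0\<close>.
\<^item> \<open>Fresh i j\<close>: on a top row just reached by a north step that raised it, at distances \<open>i\<close> and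
\<open>j\<close> from the north-east and north-west corners.
\<^item> \<open>Along b i j\<close>: on the top row, moving in direction \<open>b\<close>, at distance \<open>i\<close> from the corner ahead
and \<open>j\<close> from the corner behind.
\<^item> \<open>Flank b p h m\<close>: on the side \<open>b\<close> of a box of width \<open>m\<close>, at depth \<open>h\<close> below the top row, or at
depth \<open>h + 1\<close> if \<open>p = Downward\<close>. The shift makes the endpoint lie on the top row exactly if \<open>h =
0\<close> and \<open>p \<noteq> Downward\<close>, without the unreachable state of a descent of length \<open>0\<close>.

A walk that reaches a corner along the top row is in state \<open>Along b 0 j\<close>. In contrast to the
state \<open>Flank b Outward 0 m\<close>, in which the endpoint is also at a corner, it cannot turn south,
since the side below it has been visited.\<close>

datatype state =
    Column nat
  | Fresh nat nat
  | Along bool nat nat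
  | Flank bool phase nat nat

definition ahead :: "bool \<Rightarrow> step" where
  "ahead b = (if b then East else West)"

definition fresh :: "bool \<Rightarrow> nat \<Rightarrow> nat \<Rightarrow> state" where
  "fresh b i j = (if b then Fresh i j else Fresh j i)"

text \<open>A step ahead on the top row: beyond the corner it enlarges the box.\<close>

definition slide :: "bool \<Rightarrow> nat \<Rightarrow> nat \<Rightarrow> state" where
  "slide b i j = (case i of 0 \<Rightarrow> Flank b Outward 0 (Suc j) | Suc i' \<Rightarrow> Along b i' (Suc j))"

text \<open>A north step on a side: from the corner it raises the top row.\<close>

definition climb :: "bool \<Rightarrow> nat \<Rightarrow> nat \<Rightarrow> state" where
  "climb b h m = (case h of 0 \<Rightarrow> fresh b 0 m | Suc h' \<Rightarrow> Flank b Upward h' m)"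

fun move :: "state \<Rightarrow> step \<Rightarrow> state option" where
  "move (Column h) North = (if h = 0 then Some (Fresh 0 0) else None)"
| "move (Column h) South = Some (Column (Suc h))"
| "move (Column h) East = Some (Flank True Outward h 1)"
| "move (Column h) West = Some (Flank False Outward h 1)"
| "move (Fresh i j) North = Some (Fresh i j)"
| "move (Fresh i j) South = None"
| "move (Fresh i j) East = Some (slide True i j)"
| "move (Fresh i j) West = Some (slide False j i)"
| "move (Along b i j) s =
     (if s = North then Some (fresh b i j) else if s = ahead b then Some (slide b i j) else None)"
| "move (Flank b Outward h m) s =
     (if s = North then Some (climb b h m) else if s = South then Some (Flank b Downward h m)
      else if s = ahead b then Some (Flank b Outward h (Suc m)) else None)"
| "move (Flank b Upward h m) s =
     (if s = North then Some (climb b h m)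
      else if s = ahead b then Some (Flank b Outward h (Suc m)) else None)"
| "move (Flank b Downward h m) s =
     (if s = South then Some (Flank b Downward (Suc h) m)
      else if s = ahead b then Some (Flank b Outward (Suc h) (Suc m)) else None)"

fun corner_dists :: "state \<Rightarrow> (nat \<times> nat) option" where
  "corner_dists (Column h) = (if h = 0 then Some (0, 0) else None)"
| "corner_dists (Fresh i j) = Some (i, j)"
| "corner_dists (Along b i j) = Some (if b then (i, j) else (j, i))"
| "corner_dists (Flank b p h m) =
     (if h = 0 \<and> p \<noteq> Downward then Some (if b then (0, m) else (m, 0)) else None)"

fun width :: "state \<Rightarrow> nat" where
  "width (Column h) = 0"
| "width (Fresh i j) = i + j"
| "width (Along b i j) = i + j"
| "width (Flank b p h m) = m"

section \<open>The set of visited vertices in each state\<close>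

definition hsign :: "bool \<Rightarrow> int" where
  "hsign b = (if b then 1 else -1)"

text \<open>What the automaton knows about the visited set \<open>V\<close> of a walk ending at \<open>(x, y)\<close>. Each
clause gives the left, right and top edges of the box, as bounds with points that attain them;
it says on which side of the endpoint its own row or column has been visited; and it names a
visited vertex in the direction that is blocked.\<close>

fun shape :: "state \<Rightarrow> (int \<times> int) set \<Rightarrow> int \<Rightarrow> int \<Rightarrow> bool" where
  "shape (Column h) V x y \<longleftrightarrow>
     (\<forall>x' y'. (x', y') \<in> V \<longleftrightarrow> x' = x \<and> y \<le> y' \<and> y' \<le> y + int h)"
| "shape (Fresh i j) V x y \<longleftrightarrow>
     (\<forall>x' y'. (x', y') \<in> V \<longrightarrow>
        x - int j \<le> x' \<and> x' \<le> x + int i \<and> y' \<le> y \<and> (y' = y \<longrightarrow> x' = x)) \<and>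
     (x, y) \<in> V \<and> (x, y - 1) \<in> V \<and>
     (\<exists>y'<y. (x + int i, y') \<in> V) \<and> (\<exists>y'<y. (x - int j, y') \<in> V)"
| "shape (Along b i j) V x y \<longleftrightarrow>
     (\<forall>x' y'. (x', y') \<in> V \<longrightarrow>
        - int j \<le> hsign b * (x' - x) \<and> hsign b * (x' - x) \<le> int i \<and> y' \<le> y
        \<and> (y' = y \<longrightarrow> hsign b * (x' - x) \<le> 0)) \<and>
     (x, y) \<in> V \<and> (x - hsign b, y) \<in> V \<and>
     (\<exists>y'<y. (x + hsign b * int i, y') \<in> V) \<and> (\<exists>y'. (x - hsign b * int j, y') \<in> V)"
| "shape (Flank b Outward h m) V x y \<longleftrightarrow>
     (\<forall>x' y'. (x', y') \<in> V \<longrightarrow>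
        - int m \<le> hsign b * (x' - x) \<and> hsign b * (x' - x) \<le> 0 \<and> y' \<le> y + int h
        \<and> (x' = x \<longrightarrow> y' = y)) \<and>
     (x, y) \<in> V \<and> (x - hsign b, y) \<in> V \<and>
     (\<exists>x'. (x', y + int h) \<in> V) \<and> (\<exists>y'. (x - hsign b * int m, y') \<in> V)"
| "shape (Flank b Upward h m) V x y \<longleftrightarrow>
     (\<forall>x' y'. (x', y') \<in> V \<longrightarrow>
        - int m \<le> hsign b * (x' - x) \<and> hsign b * (x' - x) \<le> 0 \<and> y' \<le> y + int h
        \<and> (x' = x \<longrightarrow> y' \<le> y)) \<and>
     (x, y) \<in> V \<and> (x, y - 1) \<in> V \<and>
     (\<exists>x'. hsign b * (x' - x) < 0 \<and> (x', y + int h) \<in> V) \<and> (\<exists>y'. (x - hsign b * int m, y') \<in> V)"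
| "shape (Flank b Downward h m) V x y \<longleftrightarrow>
     (\<forall>x' y'. (x', y') \<in> V \<longrightarrow>
        - int m \<le> hsign b * (x' - x) \<and> hsign b * (x' - x) \<le> 0 \<and> y' \<le> y + int h + 1
        \<and> (x' = x \<longrightarrow> y \<le> y')) \<and>
     (x, y) \<in> V \<and> (x, y + 1) \<in> V \<and> m > 0 \<and>
     (\<exists>x'. (x', y + int h + 1) \<in> V) \<and> (\<exists>y'. (x - hsign b * int m, y') \<in> V)"

definition depth :: "phase \<Rightarrow> nat \<Rightarrow> nat" where
  "depth p h = (if p = Downward then Suc h else h)"

lemma shape_Flank_bounds:
  assumes "shape (Flank b p h m) V x y" "(x', y') \<in> V"
  shows "- int m \<le> hsign b * (x' - x) \<and> hsign b * (x' - x) \<le> 0 \<and> y' \<le> y + int (depth p h)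
      \<and> (p \<noteq> Downward \<longrightarrow> x' = x \<longrightarrow> y' \<le> y) \<and> (p \<noteq> Upward \<longrightarrow> x' = x \<longrightarrow> y \<le> y')"
proof (cases p)
  case Outward
  from assms(1) [unfolded Outward shape.simps, THEN conjunct1, rule_format, OF assms(2)] Outward
  show ?thesis by (simp add: depth_def)
next
  case Upward
  from assms(1) [unfolded Upward shape.simps, THEN conjunct1, rule_format, OF assms(2)] Upward
  show ?thesis by (simp add: depth_def)
next
  case Downward
  from assms(1) [unfolded Downward shape.simps, THEN conjunct1, rule_format, OF assms(2)] Downward
  show ?thesis by (simp add: depth_def)
qed

lemma shape_Flank_attained:
  assumes "shape (Flank b p h m) V x y"
  obtains x1 y2 where "(x, y) \<in> V" "(x1, y + int (depth p h)) \<in> V" "(x - hsign b * int m, y2) \<in> V"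
  using assms by (cases p) (auto simp: depth_def add_ac)

lemma unobstructedI: "(\<And>k. k \<ge> 1 \<Longrightarrow> (x + k * dx s, y + k * dy s) \<notin> V) \<Longrightarrow> unobstructed V x y s"
  by (simp add: unobstructed_def)

lemma obstructed_N: "(x, y') \<in> V \<Longrightarrow> y' > y \<Longrightarrow> \<not> unobstructed V x y North"
  by (auto simp: unobstructed_def intro!: exI [of _ "y' - y"])
lemma obstructed_S: "(x, y') \<in> V \<Longrightarrow> y' < y \<Longrightarrow> \<not> unobstructed V x y South"
  by (auto simp: unobstructed_def intro!: exI [of _ "y - y'"])
lemma obstructed_E: "(x', y) \<in> V \<Longrightarrow> x' > x \<Longrightarrow> \<not> unobstructed V x y East"
  by (auto simp: unobstructed_def intro!: exI [of _ "x' - x"])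
lemma obstructed_W: "(x', y) \<in> V \<Longrightarrow> x' < x \<Longrightarrow> \<not> unobstructed V x y West"
  by (auto simp: unobstructed_def intro!: exI [of _ "x - x'"])
lemmas obstructed = obstructed_N obstructed_S obstructed_E obstructed_W

lemma legal_Column:
  assumes "shape (Column h) V x y"
  shows "legal V x y s \<longleftrightarrow> move (Column h) s \<noteq> None"
proof (cases s)
  case North
  show ?thesis
  proof (cases "h = 0")
    case True
    thus ?thesis using assms North by (auto simp: legal_def intro!: unobstructedI)
  next
    case False
    hence "(x, y + 1) \<in> V" using assms by auto
    thus ?thesis using North False obstructed_N by (auto simp: legal_def)
  qed
qed (use assms in \<open>auto simp: legal_def intro!: unobstructedI\<close>)

lemma legal_Fresh:
  assumes "shape (Fresh i j) V x y"
  shows "legal V x y s \<longleftrightarrow> move (Fresh i j) s \<noteq> None"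
proof -
  have V: "y' \<le> y" "y' = y \<Longrightarrow> x' = x" if "(x', y') \<in> V" for x' y'
    using assms that by auto
  have below: "(x, y - 1) \<in> V"
    using assms by simp
  have "unobstructed V x y s" if "s \<noteq> South"
  proof (rule unobstructedI)
    fix k :: int assume "k \<ge> 1"
    thus "(x + k * dx s, y + k * dy s) \<notin> V"
      using V [of "x + k * dx s" "y + k * dy s"] that by (cases s) auto
  qed
  thus ?thesis
    using V obstructed_S [OF below] by (cases s) (auto simp: legal_def)
qed

text \<open>Turning south is possible only from a side of the box. At distance \<open>0\<close> from the corner
ahead the endpoint is on that side, but there the attained bound provides a visited vertex below
it.\<close>

lemma legal_Along:
  assumes "shape (Along b i j) V x y"
  shows "legal V x y s \<longleftrightarrow> move (Along b i j) s \<noteq> None"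
proof -
  have V: "- int j \<le> hsign b * (x' - x)" "hsign b * (x' - x) \<le> int i" "y' \<le> y"
     "y' = y \<Longrightarrow> hsign b * (x' - x) \<le> 0" if "(x', y') \<in> V" for x' y'
    using assms that by auto
  obtain y1 where y1: "y1 < y" "(x + hsign b * int i, y1) \<in> V" and xV: "(x - hsign b, y) \<in> V"
    using assms by auto
  have NA: "unobstructed V x y s" if "s = North \<or> s = ahead b" for s
  proof (rule unobstructedI)
    fix k :: int assume "k \<ge> 1"
    thus "(x + k * dx s, y + k * dy s) \<notin> V"
      using V [of "x + k * dx s" "y + k * dy s"] that
      by (auto simp: ahead_def hsign_def split: if_splits)
  qed
  have B: "\<not> unobstructed V x y (ahead (\<not> b))"
    using xV obstructed by (fastforce simp: ahead_def hsign_def split: if_splits)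
  have S: "\<not> legal V x y South"
  proof (cases "i = 0")
    case True
    thus ?thesis using y1 obstructed by (auto simp: legal_def)
  next
    case False
    thus ?thesis using y1 xV by (fastforce simp: legal_def hsign_def split: if_splits)
  qed
  show ?thesis
    using NA [of s] B S V by (cases b; cases s) (auto simp: legal_def ahead_def)
qed

text \<open>Turning back is blocked on the top row by a vertex visited there, and after an outward
step by the vertex just left; otherwise the endpoint would leave the side without being on the
top row.\<close>

lemma legal_Flank:
  assumes "shape (Flank b p h m) V x y"
  shows "legal V x y s \<longleftrightarrow> move (Flank b p h m) s \<noteq> None"
proof -
  note bounds = shape_Flank_bounds [OF assms]
  have V: "hsign b * (x' - x) \<le> 0" if "(x', y') \<in> V" for x' y'
    using bounds [OF that] by simp
  have A: "unobstructed V x y (ahead b)"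
  proof (rule unobstructedI)
    fix k :: int assume "k \<ge> 1"
    thus "(x + k * dx (ahead b), y + k * dy (ahead b)) \<notin> V"
      using V [of "x + k * dx (ahead b)" "y + k * dy (ahead b)"]
      by (auto simp: ahead_def hsign_def split: if_splits)
  qed
  have E: "legal V x y t" if "unobstructed V x y t" "t \<noteq> ahead (\<not> b)" for t
    using that V by (cases b; cases t) (auto simp: legal_def ahead_def hsign_def)
  have above: "y' \<le> y" if "p \<noteq> Downward" "(x, y') \<in> V" for y'
    using bounds [OF that(2)] that(1) by simp
  have below: "y \<le> y'" if "p \<noteq> Upward" "(x, y') \<in> V" for y'
    using bounds [OF that(2)] that(1) by simp
  have N: "unobstructed V x y North \<longleftrightarrow> p \<noteq> Downward"
  proof
    assume "p \<noteq> Downward"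
    thus "unobstructed V x y North"
      using above by (intro unobstructedI) fastforce
  qed (use assms obstructed_N [of x "y + 1" V y] in auto)
  have S: "unobstructed V x y South \<longleftrightarrow> p \<noteq> Upward"
  proof
    assume "p \<noteq> Upward"
    thus "unobstructed V x y South"
      using below by (intro unobstructedI) fastforce
  qed (use assms obstructed_S [of x "y - 1" V y] in auto)
  have B: "\<not> legal V x y (ahead (\<not> b))"
  proof (cases p)
    case Outward
    hence "(x - hsign b, y) \<in> V" using assms by simp
    thus ?thesis using obstructed by (fastforce simp: legal_def ahead_def hsign_def split: if_splits)
  next
    case Upward
    then obtain x1 where "hsign b * (x1 - x) < 0" "(x1, y + int h) \<in> V" using assms by auto
    thus ?thesis using obstructed
      by (cases "h = 0") (fastforce simp: legal_def ahead_def hsign_def split: if_splits)+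
  next
    case Downward
    then obtain x1 y2 where "(x1, y + int h + 1) \<in> V" "(x - hsign b * int m, y2) \<in> V" "m > 0"
      using assms by auto
    thus ?thesis by (fastforce simp: legal_def ahead_def hsign_def split: if_splits)
  qed
  have "legal V x y (ahead b)" "legal V x y North \<longleftrightarrow> p \<noteq> Downward" "legal V x y South \<longleftrightarrow> p \<noteq> Upward"
    using A N S E [of "ahead b"] E [of North] E [of South]
    by (auto simp: legal_def ahead_def split: if_splits)
  thus ?thesis
    using B by (cases p; cases b; cases s) (simp_all add: ahead_def)
qed

lemma legal_iff_move:
  assumes "shape st V x y"
  shows "legal V x y s \<longleftrightarrow> move st s \<noteq> None"
proof (cases st)
  case (Column h) thus ?thesis using assms legal_Column by metis
next
  case (Fresh i j) thus ?thesis using assms legal_Fresh by metis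
next
  case (Along b i j) thus ?thesis using assms legal_Along by metis
next
  case (Flank b p h m) thus ?thesis using assms legal_Flank by metis
qed

lemma shape_fresh:
  assumes "\<And>x' y'. (x', y') \<in> V \<Longrightarrow>
      - int j \<le> hsign b * (x' - x) \<and> hsign b * (x' - x) \<le> int i \<and> y' \<le> y"
    and "(x, y) \<in> V" "(x + hsign b * int i, y1) \<in> V" "(x - hsign b * int j, y2) \<in> V"
  shows "shape (fresh b i j) (insert (x, y + 1) V) x (y + 1)"
proof -
  have y: "y1 < y + 1" "y2 < y + 1"
    using assms(1) [OF assms(3)] assms(1) [OF assms(4)] by auto
  have V: "(if b then x - int j \<le> x' \<and> x' \<le> x + int i else x - int i \<le> x' \<and> x' \<le> x + int j)
      \<and> y' \<le> y + 1 \<and> (y' = y + 1 \<longrightarrow> x' = x)" if "(x', y') \<in> insert (x, y + 1) V" for x' y'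
    using that assms(1) [of x' y'] by (auto simp: hsign_def split: if_splits)
  show ?thesis
  proof (cases b)
    case True
    have "(x + int i, y1) \<in> V" "(x - int j, y2) \<in> V"
      using assms True by (simp_all add: hsign_def)
    thus ?thesis
      using V y assms(2) unfolding fresh_def if_P [OF True] shape.simps add_diff_cancel_right' by blast
  next
    case False
    have "(x - int i, y1) \<in> V" "(x + int j, y2) \<in> V"
      using assms False by (simp_all add: hsign_def)
    thus ?thesis
      using V y assms(2) unfolding fresh_def if_not_P [OF False] shape.simps add_diff_cancel_right' by blast
  qed
qed

lemma shape_outward:
  assumes "\<And>x' y'. (x', y') \<in> V \<Longrightarrow>
      - int m \<le> hsign b * (x' - x) \<and> hsign b * (x' - x) \<le> 0 \<and> y' \<le> y + int h"
    and "(x, y) \<in> V" "(x1, y + int h) \<in> V" "(x - hsign b * int m, y2) \<in> V"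
  shows "shape (Flank b Outward h (Suc m)) (insert (x + hsign b, y) V) (x + hsign b) y"
proof -
  have eqs: "x + hsign b - hsign b * int (Suc m) = x - hsign b * int m" "x + hsign b - hsign b = x"
    by (simp_all add: algebra_simps)
  have "- int (Suc m) \<le> hsign b * (x' - (x + hsign b)) \<and> hsign b * (x' - (x + hsign b)) \<le> 0
      \<and> y' \<le> y + int h \<and> (x' = x + hsign b \<longrightarrow> y' = y)" if "(x', y') \<in> insert (x + hsign b, y) V" for x' y'
    using that assms(1) [of x' y'] by (auto simp: hsign_def split: if_splits)
  thus ?thesis
    using assms(2-4) unfolding shape.simps eqs by blast
qed

lemma shape_slide:
  assumes "\<And>x' y'. (x', y') \<in> V \<Longrightarrow>
      - int j \<le> hsign b * (x' - x) \<and> hsign b * (x' - x) \<le> int i \<and> y' \<le> y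
      \<and> (y' = y \<longrightarrow> hsign b * (x' - x) \<le> 0)"
    and "(x, y) \<in> V" "(x + hsign b * int i, y1) \<in> V" "y1 < y" "(x - hsign b * int j, y2) \<in> V"
  shows "shape (slide b i j) (insert (x + hsign b, y) V) (x + hsign b) y"
proof (cases i)
  case 0
  show ?thesis
    unfolding 0 slide_def nat.case
    by (rule shape_outward [where ?x1.0 = x and ?y2.0 = y2]) (use assms 0 in auto)
next
  case (Suc i')
  have eqs: "x + hsign b + hsign b * int i' = x + hsign b * int i"
      "x + hsign b - hsign b * int (Suc j) = x - hsign b * int j" "x + hsign b - hsign b = x"
    by (simp_all add: Suc algebra_simps)
  have "- int (Suc j) \<le> hsign b * (x' - (x + hsign b)) \<and> hsign b * (x' - (x + hsign b)) \<le> int i'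
      \<and> y' \<le> y \<and> (y' = y \<longrightarrow> hsign b * (x' - (x + hsign b)) \<le> 0)" if "(x', y') \<in> insert (x + hsign b, y) V" for x' y'
    using that assms(1) [of x' y'] Suc by (auto simp: hsign_def split: if_splits)
  hence "shape (Along b i' (Suc j)) (insert (x + hsign b, y) V) (x + hsign b) y"
    using assms(2-5) unfolding shape.simps eqs by blast
  thus ?thesis by (simp add: Suc slide_def)
qed

lemma shape_climb:
  assumes "\<And>x' y'. (x', y') \<in> V \<Longrightarrow>
      - int m \<le> hsign b * (x' - x) \<and> hsign b * (x' - x) \<le> 0 \<and> y' \<le> y + int h
      \<and> (x' = x \<longrightarrow> y' \<le> y)"
    and "(x, y) \<in> V" "(x1, y + int h) \<in> V" "(x - hsign b * int m, y2) \<in> V"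
  shows "shape (climb b h m) (insert (x, y + 1) V) x (y + 1)"
proof (cases h)
  case 0
  show ?thesis
    unfolding 0 climb_def nat.case
    by (rule shape_fresh [where ?y1.0 = y and ?y2.0 = y2]) (use assms 0 in auto)
next
  case (Suc h')
  have "hsign b * (x1 - x) < 0"
    using assms(1) [OF assms(3)] Suc by (auto simp: hsign_def split: if_splits)
  moreover have eqs: "y + 1 + int h' = y + int h" "y + 1 - 1 = y"
    by (simp_all add: Suc)
  moreover have "- int m \<le> hsign b * (x' - x) \<and> hsign b * (x' - x) \<le> 0 \<and> y' \<le> y + 1 + int h'
      \<and> (x' = x \<longrightarrow> y' \<le> y + 1)" if "(x', y') \<in> insert (x, y + 1) V" for x' y'
    using that assms(1) [of x' y'] Suc by auto
  ultimately have "shape (Flank b Upward h' m) (insert (x, y + 1) V) x (y + 1)"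
    using assms(2-4) unfolding shape.simps eqs by blast
  thus ?thesis by (simp add: Suc climb_def)
qed

lemma shape_downward:
  assumes "\<And>x' y'. (x', y') \<in> V \<Longrightarrow>
      - int m \<le> hsign b * (x' - x) \<and> hsign b * (x' - x) \<le> 0 \<and> y' \<le> y + int h
      \<and> (x' = x \<longrightarrow> y \<le> y')"
    and "(x, y) \<in> V" "0 < m" "(x1, y + int h) \<in> V" "(x - hsign b * int m, y2) \<in> V"
  shows "shape (Flank b Downward h m) (insert (x, y - 1) V) x (y - 1)"
proof -
  have "- int m \<le> hsign b * (x' - x) \<and> hsign b * (x' - x) \<le> 0 \<and> y' \<le> y + int h
      \<and> (x' = x \<longrightarrow> y - 1 \<le> y')" if "(x', y') \<in> insert (x, y - 1) V" for x' y'
    using that assms(1) [of x' y'] assms(1) [OF assms(2)] by auto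
  moreover have "y - 1 + int h + 1 = y + int h" "y - 1 + 1 = y"
    by simp_all
  ultimately show ?thesis
    using assms(2-5) by (simp only: shape.simps) blast
qed

lemma step_ahead [simp]:
  "dx (ahead b) = hsign b" "dy (ahead b) = 0" "ahead b \<noteq> North" "ahead b \<noteq> South"
  "North \<noteq> ahead b" "South \<noteq> ahead b"
  by (simp_all add: ahead_def hsign_def)

lemma hsign_simps [simp]: "hsign True = 1" "hsign False = -1"
  by (simp_all add: hsign_def)

lemma shape_move_Column:
  assumes "shape (Column h) V x y" "move (Column h) s = Some st'"
  shows "shape st' (insert (x + dx s, y + dy s) V) (x + dx s) (y + dy s)"
proof -
  have V: "(x', y') \<in> V \<longleftrightarrow> x' = x \<and> y \<le> y' \<and> y' \<le> y + int h" for x' y'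
    using assms by simp
  show ?thesis
  proof (cases s)
    case North
    thus ?thesis using assms shape_fresh [of V 0 True x 0 y y y] V
      by (auto simp: fresh_def split: if_splits)
  next
    case South
    thus ?thesis using assms by auto
  next
    case East
    thus ?thesis using assms shape_outward [of V 0 True x y h x y] V by auto
  next
    case West
    thus ?thesis using assms shape_outward [of V 0 False x y h x y] V by auto
  qed
qed

lemma shape_move_Fresh:
  assumes "shape (Fresh i j) V x y" "move (Fresh i j) s = Some st'"
  shows "shape st' (insert (x + dx s, y + dy s) V) (x + dx s) (y + dy s)"
proof -
  have VT: "- int j \<le> hsign True * (x' - x) \<and> hsign True * (x' - x) \<le> int i \<and> y' \<le> y
      \<and> (y' = y \<longrightarrow> hsign True * (x' - x) \<le> 0)" if "(x', y') \<in> V" for x' y'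
    using assms(1) [unfolded shape.simps, THEN conjunct1, rule_format, OF that] by auto
  have VF: "- int i \<le> hsign False * (x' - x) \<and> hsign False * (x' - x) \<le> int j \<and> y' \<le> y
      \<and> (y' = y \<longrightarrow> hsign False * (x' - x) \<le> 0)" if "(x', y') \<in> V" for x' y'
    using assms(1) [unfolded shape.simps, THEN conjunct1, rule_format, OF that] by auto
  obtain y1 y2 where in_V: "(x, y) \<in> V" "(x + hsign True * int i, y1) \<in> V" "y1 < y"
      "(x - hsign True * int j, y2) \<in> V" "y2 < y"
    using assms(1) by auto
  hence in_V': "(x + hsign False * int j, y2) \<in> V" "(x - hsign False * int i, y1) \<in> V"
    by simp_all
  show ?thesis
  proof (cases s)
    case North
    have "shape (fresh True i j) (insert (x, y + 1) V) x (y + 1)"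
      by (rule shape_fresh [of _ _ _ _ _ _ y1 y2]) (use VT in_V in blast)+
    moreover have "st' = fresh True i j"
      using assms(2) North by (simp add: fresh_def)
    ultimately show ?thesis
      using North by (simp del: shape.simps)
  next
    case South
    thus ?thesis using assms(2) by simp
  next
    case East
    have "shape (slide True i j) (insert (x + hsign True, y) V) (x + hsign True) y"
      by (rule shape_slide [of _ _ _ _ _ _ y1 y2]) (use VT in_V in blast)+
    thus ?thesis using assms(2) East by simp
  next
    case West
    have "shape (slide False j i) (insert (x + hsign False, y) V) (x + hsign False) y"
      by (rule shape_slide [of _ _ _ _ _ _ y2 y1]) (use VF in_V in_V' in blast)+
    thus ?thesis using assms(2) West by simp
  qed
qed

lemma shape_move_Along:
  assumes "shape (Along b i j) V x y" "move (Along b i j) s = Some st'"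
  shows "shape st' (insert (x + dx s, y + dy s) V) (x + dx s) (y + dy s)"
proof -
  have V: "- int j \<le> hsign b * (x' - x) \<and> hsign b * (x' - x) \<le> int i \<and> y' \<le> y
      \<and> (y' = y \<longrightarrow> hsign b * (x' - x) \<le> 0)" if "(x', y') \<in> V" for x' y'
    using assms(1) that by simp
  obtain y1 y2 where in_V: "(x, y) \<in> V" "(x + hsign b * int i, y1) \<in> V" "y1 < y" "(x - hsign b * int j, y2) \<in> V"
    using assms(1) by auto
  have "shape (fresh b i j) (insert (x, y + 1) V) x (y + 1)"
    by (rule shape_fresh [of _ _ _ _ _ _ y1 y2]) (use V in_V in blast)+
  moreover have "shape (slide b i j) (insert (x + hsign b, y) V) (x + hsign b) y"
    by (rule shape_slide [of _ _ _ _ _ _ y1 y2]) (use V in_V in blast)+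
  ultimately show ?thesis
    using assms(2) by (auto split: if_splits)
qed

lemma shape_move_Flank:
  assumes "shape (Flank b p h m) V x y" "move (Flank b p h m) s = Some st'"
  shows "shape st' (insert (x + dx s, y + dy s) V) (x + dx s) (y + dy s)"
proof -
  define k where "k = depth p h"
  note V = shape_Flank_bounds [OF assms(1), folded k_def]
  obtain x1 y2 where in_V: "(x, y) \<in> V" "(x1, y + int k) \<in> V" "(x - hsign b * int m, y2) \<in> V"
    unfolding k_def by (rule shape_Flank_attained [OF assms(1)])
  have "0 < m"
  proof (cases p)
    case Outward
    hence "(x - hsign b, y) \<in> V" using assms(1) by simp
    from V [OF this] show ?thesis by (cases b) auto
  next
    case Upward
    then obtain x' where "(x', y + int h) \<in> V" "hsign b * (x' - x) < 0" using assms(1) by auto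
    with V [OF this(1)] show ?thesis by linarith
  qed (use assms(1) in simp)
  have climb: "shape (climb b k m) (insert (x, y + 1) V) x (y + 1)" if "p \<noteq> Downward"
    by (rule shape_climb [of _ _ _ _ _ _ x1 y2]) (use V in_V that in blast)+
  have out: "shape (Flank b Outward k (Suc m)) (insert (x + hsign b, y) V) (x + hsign b) y"
    by (rule shape_outward [of _ _ _ _ _ _ x1 y2]) (use V in_V in blast)+
  have down: "shape (Flank b Downward k m) (insert (x, y - 1) V) x (y - 1)" if "p \<noteq> Upward"
    by (rule shape_downward [of _ _ _ _ _ _ x1 y2]) (use V in_V that \<open>0 < m\<close> in blast)+
  show ?thesis
    using assms(2) climb out down
    by (cases p) (auto simp: k_def depth_def simp del: shape.simps split: if_splits)
qed

lemma shape_move: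
  assumes "shape st V x y" "move st s = Some st'"
  shows "shape st' (insert (x + dx s, y + dy s) V) (x + dx s) (y + dy s)"
proof (cases st)
  case (Column h) thus ?thesis using assms shape_move_Column by metis
next
  case (Fresh i j) thus ?thesis using assms shape_move_Fresh by metis
next
  case (Along b i j) thus ?thesis using assms shape_move_Along by metis
next
  case (Flank b p h m) thus ?thesis using assms shape_move_Flank by metis
qed

definition run :: "step list \<Rightarrow> state option" where
  "run w = foldl (\<lambda>st s. Option.bind st (\<lambda>st. move st s)) (Some (Column 0)) w"

lemma run_Nil: "run [] = Some (Column 0)"
  and run_snoc: "run (w @ [s]) = Option.bind (run w) (\<lambda>st. move st s)"
  by (simp_all add: run_def)

lemma run_shape: "run w = Some st \<Longrightarrow> shape st (visited w) (fst (endpoint w)) (snd (endpoint w))"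
proof (induction w arbitrary: st rule: rev_induct)
  case Nil
  thus ?case by (auto simp: run_Nil visited_Nil endpoint_def)
next
  case (snoc s w)
  then obtain st' where "run w = Some st'" "move st' s = Some st"
    by (auto simp: run_snoc bind_eq_Some_conv)
  thus ?case
    using shape_move [OF snoc.IH] by (simp add: visited_snoc endpoint_snoc)
qed

text \<open>The automaton accepts exactly the three-sided walks: by \<open>run_shape\<close> its state describes
the visited set well enough to decide which steps are legal.\<close>

lemma three_sided_iff_run: "three_sided w \<longleftrightarrow> run w \<noteq> None"
proof (induction w rule: rev_induct)
  case (snoc s w)
  show ?case
  proof (cases "run w")
    case None
    thus ?thesis using snoc by (simp add: three_sided_snoc run_snoc)
  next
    case (Some st)
    thus ?thesis
      using snoc legal_iff_move [OF run_shape] by (simp add: three_sided_snoc run_snoc)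
  qed
qed (simp add: three_sided_Nil run_Nil)

lemma Max_image_eqI:
  fixes V :: "(int \<times> int) set"
  assumes "finite V" "\<And>p. p \<in> V \<Longrightarrow> f p \<le> (m::int)" "p \<in> V" "f p = m"
  shows "Max (f ` V) = m"
  using assms by (intro Max_eqI) auto

lemma Min_image_eqI:
  fixes V :: "(int \<times> int) set"
  assumes "finite V" "\<And>p. p \<in> V \<Longrightarrow> (m::int) \<le> f p" "p \<in> V" "f p = m"
  shows "Min (f ` V) = m"
  using assms by (intro Min_eqI) auto

text \<open>The distances from the endpoint to the right, left and top edges of the box.\<close>

fun extents :: "state \<Rightarrow> nat \<times> nat \<times> nat" where
  "extents (Column h) = (0, 0, h)"
| "extents (Fresh i j) = (i, j, 0)"
| "extents (Along b i j) = (if b then (i, j, 0) else (j, i, 0))"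
| "extents (Flank b p h m)
     = (if b then 0 else m, if b then m else 0, depth p h)"

lemma shape_extents:
  assumes "shape st V x y" "extents st = (e, w, n)"
  shows "(\<forall>x' y'. (x', y') \<in> V \<longrightarrow> x - int w \<le> x' \<and> x' \<le> x + int e \<and> y' \<le> y + int n)
     \<and> (\<exists>y'. (x + int e, y') \<in> V) \<and> (\<exists>y'. (x - int w, y') \<in> V) \<and> (\<exists>x'. (x', y + int n) \<in> V)"
proof (cases st)
  case (Column h)
  thus ?thesis using assms by auto
next
  case (Fresh i j)
  thus ?thesis using assms by auto
next
  case (Along b i j)
  have "- int j \<le> hsign b * (x' - x) \<and> hsign b * (x' - x) \<le> int i \<and> y' \<le> y"
    if "(x', y') \<in> V" for x' y'
    using assms(1) [unfolded Along shape.simps, THEN conjunct1, rule_format, OF that] by simp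
  moreover obtain y1 y2 where "(x, y) \<in> V" "(x + hsign b * int i, y1) \<in> V" "(x - hsign b * int j, y2) \<in> V"
    using assms(1) Along by auto
  ultimately show ?thesis
    using assms(2) Along by (cases b) fastforce+
next
  case (Flank b p h m)
  note shape = assms(1) [unfolded Flank]
  have V: "- int m \<le> hsign b * (x' - x) \<and> hsign b * (x' - x) \<le> 0 \<and> y' \<le> y + int (depth p h)"
    if "(x', y') \<in> V" for x' y'
    using shape_Flank_bounds [OF shape that] by simp
  obtain x1 y2 where "(x, y) \<in> V" "(x1, y + int (depth p h)) \<in> V" "(x - hsign b * int m, y2) \<in> V"
    by (rule shape_Flank_attained [OF shape])
  with V show ?thesis
    using assms(2) Flank by (cases b) fastforce+
qed

lemma run_box:
  assumes "run w = Some st" "extents st = (e, f, n)"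
  shows "box_right w = fst (endpoint w) + int e" "box_left w = fst (endpoint w) - int f"
    "box_top w = snd (endpoint w) + int n"
proof -
  let ?x = "fst (endpoint w)" and ?y = "snd (endpoint w)"
  from shape_extents [OF run_shape [OF assms(1)] assms(2)]
  obtain x1 y1 y2 where bounds: "\<And>x' y'. (x', y') \<in> visited w \<Longrightarrow>
      ?x - int f \<le> x' \<and> x' \<le> ?x + int e \<and> y' \<le> ?y + int n"
    and east: "(?x + int e, y1) \<in> visited w" and west: "(?x - int f, y2) \<in> visited w"
    and north: "(x1, ?y + int n) \<in> visited w"
    by blast
  show "box_right w = ?x + int e"
    unfolding box_right_def using bounds east by (intro Max_image_eqI [OF finite_visited _ east]) auto
  show "box_left w = ?x - int f"
    unfolding box_left_def using bounds west by (intro Min_image_eqI [OF finite_visited _ west]) auto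
  show "box_top w = ?y + int n"
    unfolding box_top_def using bounds north by (intro Max_image_eqI [OF finite_visited _ north]) auto
qed

lemma corner_dists_extents:
  "corner_dists st = (case extents st of (e, f, n) \<Rightarrow> if n = 0 then Some (e, f) else None)"
  by (cases st) (simp_all add: depth_def)

lemma width_extents: "width st = (case extents st of (e, f, n) \<Rightarrow> e + f)"
  by (cases st) simp_all

lemma run_statistics:
  assumes "run w = Some st"
  shows "corner_dists st = (if ends_on_top w then Some (dist_NE w, dist_NW w) else None)"
    and "width st = box_width w"
proof -
  obtain e f n where ext: "extents st = (e, f, n)"
    by (cases "extents st")
  note box = run_box [OF assms ext]
  have "ends_on_top w \<longleftrightarrow> n = 0" "dist_NE w = e" "dist_NW w = f" "box_width w = e + f"
    by (simp_all add: ends_on_top_def dist_NE_def dist_NW_def box_width_def box)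
  thus "corner_dists st = (if ends_on_top w then Some (dist_NE w, dist_NW w) else None)"
    and "width st = box_width w"
    by (simp_all add: corner_dists_extents width_extents ext)
qed

section \<open>Generating functions as functionals on states\<close>

definition next_sum :: "(state \<Rightarrow> 'a::comm_ring_1) \<Rightarrow> state \<Rightarrow> 'a" where
  "next_sum F s = (\<Sum>a\<in>{North, East, South, West}. case move s a of None \<Rightarrow> 0 | Some s' \<Rightarrow> F s')"

definition path_gf :: "(state \<Rightarrow> 'a::field_char_0 fps) \<Rightarrow> 'a fps" where
  "path_gf F = Abs_fps (\<lambda>n. (\<Sum>k\<le>n. fps_X ^ k * (next_sum ^^ k) F (Column 0)) $ n)"

lemma next_sum_add: "next_sum (\<lambda>s. F s + G s) = (\<lambda>s. next_sum F s + next_sum G s)"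
  by (rule ext) (simp add: next_sum_def sum.distrib [symmetric] algebra_simps split: option.splits)

lemma next_sum_mult: "next_sum (\<lambda>s. c * F s) = (\<lambda>s. c * next_sum F s)"
  by (rule ext) (simp add: next_sum_def algebra_simps split: option.splits)

lemma funpow_next_sum_add:
  "(next_sum ^^ k) (\<lambda>s. F s + G s) = (\<lambda>s. (next_sum ^^ k) F s + (next_sum ^^ k) G s)"
  by (induction k) (simp_all add: next_sum_add)

lemma funpow_next_sum_mult:
  "(next_sum ^^ k) (\<lambda>s. c * F s) = (\<lambda>s. c * (next_sum ^^ k) F s)"
  by (induction k) (simp_all add: next_sum_mult)

lemma fps_X_power_sum_nth_cong:
  fixes a :: "nat \<Rightarrow> 'a::comm_ring_1 fps"
  assumes "i \<le> n"
  shows "(\<Sum>k\<le>n. fps_X ^ k * a k) $ i = (\<Sum>k\<le>i. fps_X ^ k * a k) $ i"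
proof -
  have "(\<Sum>k\<le>n. (fps_X ^ k * a k) $ i) = (\<Sum>k\<le>i. (fps_X ^ k * a k) $ i)"
    using assms by (intro sum.mono_neutral_right) (auto simp: fps_X_power_mult_nth)
  thus ?thesis by (simp add: fps_sum_nth)
qed

lemma path_gf_nth:
  assumes "i \<le> n"
  shows "path_gf F $ i = (\<Sum>k\<le>n. fps_X ^ k * (next_sum ^^ k) F (Column 0)) $ i"
  unfolding fps_X_power_sum_nth_cong [OF assms] by (simp add: path_gf_def)

lemma path_gf_sums: "(\<lambda>n. fps_X ^ n * (next_sum ^^ n) F (Column 0)) sums path_gf F"
  unfolding sums_def_le
proof (rule tendsto_fpsI)
  fix n
  show "eventually (\<lambda>m. (\<Sum>k\<le>m. fps_X ^ k * (next_sum ^^ k) F (Column 0)) $ n = path_gf F $ n)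
      sequentially"
    using path_gf_nth [of n _ F] by (intro eventually_sequentiallyI [of n]) simp
qed

lemma path_gf_add: "path_gf (\<lambda>s. F s + G s) = path_gf F + path_gf G"
  by (rule fps_ext) (simp add: path_gf_def funpow_next_sum_add algebra_simps sum.distrib)

lemma path_gf_mult: "path_gf (\<lambda>s. c * F s) = c * path_gf F"
proof (rule fps_ext)
  fix n
  have "(c * path_gf F) $ n
      = (c * (\<Sum>k\<le>n. fps_X ^ k * (next_sum ^^ k) F (Column 0))) $ n"
    using path_gf_nth [of _ n F] by (simp add: fps_mult_nth)
  also have "\<dots> = path_gf (\<lambda>s. c * F s) $ n"
    by (simp add: path_gf_def funpow_next_sum_mult sum_distrib_left mult.left_commute)
  finally show "path_gf (\<lambda>s. c * F s) $ n = (c * path_gf F) $ n" ..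
qed

lemma path_gf_rec: "path_gf F = F (Column 0) + fps_X * path_gf (next_sum F)"
proof (rule fps_ext)
  fix n
  have "path_gf F $ n = (F (Column 0)
      + fps_X * (\<Sum>k<n. fps_X ^ k * (next_sum ^^ k) (next_sum F) (Column 0))) $ n"
    by (simp add: path_gf_def sum.atMost_shift sum_distrib_left funpow_Suc_right mult.assoc
          del: funpow.simps)
  also have "\<dots> = (F (Column 0) + fps_X * path_gf (next_sum F)) $ n"
    by (cases n) (simp_all add: path_gf_def flip: lessThan_Suc_atMost)
  finally show "path_gf F $ n = \<dots>" .
qed

text \<open>Every walk is empty or a walk followed by one more step, so that summing a function \<open>G\<close>
over final states and summing \<open>t\<close> times its successor sum differ by the value of \<open>G\<close> at the
start.\<close>

lemma path_gf_potential:
  assumes "\<And>s. R s = G s - fps_X * next_sum G s"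
  shows "path_gf R = G (Column 0)"
proof -
  have "path_gf G = path_gf (\<lambda>s. R s + fps_X * next_sum G s)"
    using assms by (simp add: algebra_simps)
  also have "\<dots> = path_gf R + fps_X * path_gf (next_sum G)"
    by (simp add: path_gf_add path_gf_mult)
  finally show ?thesis using path_gf_rec [of G] by simp
qed

text \<open>Reflection in the vertical axis. It exchanges the two sides and hence the two arguments of
\<open>T\<close>.\<close>

fun mirror :: "state \<Rightarrow> state" where
  "mirror (Column h) = Column h"
| "mirror (Fresh i j) = Fresh j i"
| "mirror (Along b i j) = Along (\<not> b) i j"
| "mirror (Flank b p h m) = Flank (\<not> b) p h m"

lemma next_sum_mirror: "next_sum (\<lambda>s. F (mirror s)) = (\<lambda>s. next_sum F (mirror s))"
proof
  fix s
  show "next_sum (\<lambda>s. F (mirror s)) s = next_sum F (mirror s)"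
    by (cases "(s, West)" rule: move.cases)
       (auto simp: next_sum_def ahead_def slide_def climb_def fresh_def split: nat.splits)
qed

lemma path_gf_mirror: "path_gf (\<lambda>s. F (mirror s)) = path_gf F"
proof -
  have "(next_sum ^^ k) (\<lambda>s. F (mirror s)) = (\<lambda>s. (next_sum ^^ k) F (mirror s))" for k
    by (induction k) (simp_all add: next_sum_mirror)
  thus ?thesis by (simp add: path_gf_def)
qed

lemma finite_words: "finite {w :: step list. length w = n}"
proof -
  have "finite (UNIV :: step set)"
    by (rule finite_subset [of _ "{North, East, South, West}"]) (use step.exhaust in auto)
  thus ?thesis using finite_lists_length_eq [of "UNIV :: step set" n] by simp
qed

lemma sum_run:
  "(\<Sum>w | length w = n. case run w of None \<Rightarrow> 0 | Some st \<Rightarrow> F st) = (next_sum ^^ n) F (Column 0)"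
proof (induction n arbitrary: F)
  case 0
  have "{w :: step list. length w = 0} = {[]}" by auto
  thus ?case by (simp add: run_Nil)
next
  case (Suc n)
  let ?f = "\<lambda>w. case run w of None \<Rightarrow> 0 | Some st \<Rightarrow> F st"
  let ?S = "{North, East, South, West}"
  have eq: "{w :: step list. length w = Suc n} = (\<lambda>(w, s). w @ [s]) ` ({w. length w = n} \<times> ?S)"
  proof (intro equalityI subsetI)
    fix w :: "step list" assume "w \<in> {w. length w = Suc n}"
    moreover from this obtain v s where "w = v @ [s]"
      by (cases w rule: rev_cases) auto
    ultimately show "w \<in> (\<lambda>(w, s). w @ [s]) ` ({w. length w = n} \<times> ?S)"
      by (cases s) auto
  qed auto
  have inj: "inj_on (\<lambda>(w, s :: step). w @ [s]) ({w. length w = n} \<times> ?S)"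
    by (auto simp: inj_on_def)
  have "(\<Sum>w | length w = Suc n. ?f w)
      = (\<Sum>(w, s)\<in>{w. length w = n} \<times> ?S. ?f (w @ [s]))"
    unfolding eq sum.reindex [OF inj] by (simp add: case_prod_beta)
  also have "\<dots> = (\<Sum>w | length w = n. \<Sum>s\<in>?S. ?f (w @ [s]))"
    by (rule sum.cartesian_product [symmetric])
  also have "\<dots> = (\<Sum>w | length w = n. case run w of None \<Rightarrow> 0 | Some st \<Rightarrow> next_sum F st)"
    by (intro sum.cong) (simp_all add: run_snoc next_sum_def split: option.split)
  also have "\<dots> = (next_sum ^^ Suc n) F (Column 0)"
    using Suc.IH [of "next_sum F"] by (simp add: funpow_swap1)
  finally show ?case .
qed

text \<open>The passage from sums over walks to \<open>path_gf\<close>; \<open>Q\<close> selects a class of three-sided walks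
and \<open>g\<close> weighs its members.\<close>

lemma suminf_walks:
  assumes "\<And>w st. run w = Some st \<Longrightarrow> F st = (if Q w then g w else 0)"
  shows "(\<Sum>n. fps_X ^ n * (\<Sum>w | length w = n \<and> three_sided w \<and> Q w. g w)) = path_gf F"
proof -
  have "(\<Sum>w | length w = n \<and> three_sided w \<and> Q w. g w) = (next_sum ^^ n) F (Column 0)" for n
  proof -
    have "(\<Sum>w | length w = n \<and> three_sided w \<and> Q w. g w)
        = (\<Sum>w | length w = n. if three_sided w \<and> Q w then g w else 0)"
      using finite_words by (subst sum.inter_filter [symmetric]) simp_all
    also have "\<dots> = (\<Sum>w | length w = n. case run w of None \<Rightarrow> 0 | Some st \<Rightarrow> F st)"
      using assms by (intro sum.cong) (auto simp: three_sided_iff_run split: option.split)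
    finally show ?thesis by (simp add: sum_run)
  qed
  thus ?thesis using path_gf_sums [of F] by (simp add: sums_iff)
qed

section \<open>Functional equations from potentials\<close>

lemma next_sum_simps:
  "next_sum F (Column h) = (if h = 0 then F (Fresh 0 0) else 0) + F (Column (Suc h))
     + F (Flank True Outward h 1) + F (Flank False Outward h 1)"
  "next_sum F (Fresh i j) = F (Fresh i j) + F (slide True i j) + F (slide False j i)"
  "next_sum F (Along b i j) = F (fresh b i j) + F (slide b i j)"
  "next_sum F (Flank b Outward h m)
     = F (climb b h m) + F (Flank b Downward h m) + F (Flank b Outward h (Suc m))"
  "next_sum F (Flank b Upward h m) = F (climb b h m) + F (Flank b Outward h (Suc m))"
  "next_sum F (Flank b Downward h m)
     = F (Flank b Downward (Suc h) m) + F (Flank b Outward (Suc h) (Suc m))"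
  by (auto simp: next_sum_def ahead_def add_ac)

definition top_weight :: "'a::field_char_0 fps \<Rightarrow> 'a fps \<Rightarrow> state \<Rightarrow> 'a fps" where
  "top_weight x y s = (case corner_dists s of None \<Rightarrow> 0 | Some (i, j) \<Rightarrow> x ^ i * y ^ j)"

fun fresh_weight :: "'a::field_char_0 fps \<Rightarrow> 'a fps \<Rightarrow> state \<Rightarrow> 'a fps" where
  "fresh_weight x y (Fresh i j) = x ^ i * y ^ j"
| "fresh_weight x y _ = 0"

fun along_weight :: "bool \<Rightarrow> 'a::field_char_0 fps \<Rightarrow> 'a fps \<Rightarrow> state \<Rightarrow> 'a fps" where
  "along_weight b x y (Along b' i j) = (if b' = b then x ^ i * y ^ j else 0)"
| "along_weight b x y _ = 0"

fun corner_weight :: "bool \<Rightarrow> 'a::field_char_0 fps \<Rightarrow> state \<Rightarrow> 'a fps" where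
  "corner_weight b v (Flank b' p h m) = (if b' = b \<and> p \<noteq> Downward \<and> h = 0 then v ^ m else 0)"
| "corner_weight b v _ = 0"

fun flank_weight :: "bool \<Rightarrow> 'a::field_char_0 fps \<Rightarrow> state \<Rightarrow> 'a fps" where
  "flank_weight b v (Flank b' p h m) = (if b' = b then v ^ m else 0)"
| "flank_weight b v _ = 0"

fun column_weight :: "state \<Rightarrow> 'a::field_char_0 fps" where
  "column_weight (Column h) = 1"
| "column_weight _ = 0"

fun start_weight :: "state \<Rightarrow> 'a::field_char_0 fps" where
  "start_weight (Column h) = (if h = 0 then 1 else 0)"
| "start_weight _ = 0"

lemma path_gf_start: "path_gf start_weight = 1"
proof -
  have "path_gf start_weight = (start_weight (Column 0) :: 'a fps)"
  proof (rule path_gf_potential)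
    fix s show "start_weight s = start_weight s - fps_X * next_sum start_weight s"
      by (cases "(s, West)" rule: move.cases)
         (auto simp: next_sum_simps slide_def climb_def fresh_def split: nat.splits)
  qed
  thus ?thesis by simp
qed

lemma path_gf_column: "(1 - fps_X) * path_gf column_weight = (1 :: 'a::field_char_0 fps)"
proof -
  have "path_gf (\<lambda>s. (1 - fps_X) * column_weight s) = (column_weight (Column 0) :: 'a fps)"
  proof (rule path_gf_potential)
    fix s show "(1 - fps_X) * column_weight s = column_weight s - fps_X * next_sum column_weight s"
      by (cases "(s, West)" rule: move.cases)
         (auto simp: next_sum_simps slide_def climb_def fresh_def algebra_simps split: nat.splits)
  qed
  thus ?thesis by (simp add: path_gf_mult)
qed

text \<open>A walk in a state \<open>Fresh i j\<close> is a walk ending on top with the same distances, followed by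
a north step.\<close>

lemma path_gf_fresh:
  "path_gf (fresh_weight x y) = fps_X * path_gf (top_weight x y)"
proof -
  have "path_gf (\<lambda>s. fresh_weight x y s + (- fps_X) * top_weight x y s) = fresh_weight x y (Column 0)"
  proof (rule path_gf_potential)
    fix s
    show "fresh_weight x y s + (- fps_X) * top_weight x y s
        = fresh_weight x y s - fps_X * next_sum (fresh_weight x y) s"
      by (cases "(s, West)" rule: move.cases)
         (auto simp: next_sum_simps top_weight_def slide_def climb_def fresh_def split: nat.splits)
  qed
  thus ?thesis unfolding path_gf_add path_gf_mult by simp
qed

text \<open>Turns a weight in terms of the distances to the corners ahead and behind into one in terms
of the distances to the north-east and north-west corners.\<close>

definition oriented :: "bool \<Rightarrow> ('b \<Rightarrow> 'b \<Rightarrow> 'c) \<Rightarrow> 'b \<Rightarrow> 'b \<Rightarrow> 'c" where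
  "oriented b f x y = (if b then f x y else f y x)"

text \<open>A walk moving in direction \<open>d\<close> on the top row started from a state \<open>Fresh\<close> and has not
gone beyond the corner. Summing over the number of its horizontal steps gives a geometric sum
with ratio \<open>tb/a\<close>, in which the upper end contributes the weight with \<open>a\<close> replaced by \<open>tb\<close>. The
common factor \<open>u\<close> of the two variables is kept apart, so that it does not enter the
coefficients.\<close>

lemma path_gf_along:
  fixes u a b :: "'a::field_char_0 fps"
  shows "(a - fps_X * b) * path_gf (along_weight d (u * a) (u * b))
       = fps_X^2 * b * (path_gf (oriented d top_weight (u * a) (u * b))
          - path_gf (oriented d top_weight (u * (fps_X * b)) (u * b)))"
proof -
  define G where "G = (\<lambda>s. a * along_weight d (u * a) (u * b) s
      - fps_X * b * along_weight d (u * (fps_X * b)) (u * b) s)"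
  define A where "A = oriented d fresh_weight (u * a) (u * b)"
  define B where "B = oriented d fresh_weight (u * (fps_X * b)) (u * b)"
  have "path_gf (\<lambda>s. (a - fps_X * b) * along_weight d (u * a) (u * b) s
      + (- (fps_X * b)) * (A s + (- 1) * B s)) = G (Column 0)"
  proof (rule path_gf_potential)
    fix s
    show "(a - fps_X * b) * along_weight d (u * a) (u * b) s
      + (- (fps_X * b)) * (A s + (- 1) * B s) = G s - fps_X * next_sum G s"
      by (cases "(s, West)" rule: move.cases)
         (auto simp: next_sum_simps G_def A_def B_def oriented_def slide_def climb_def fresh_def
           power_mult_distrib algebra_simps split: nat.splits)
  qed
  hence "(a - fps_X * b) * path_gf (along_weight d (u * a) (u * b))
      = fps_X * b * (path_gf A - path_gf B)"
    unfolding path_gf_add path_gf_mult by (simp add: G_def algebra_simps)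
  thus ?thesis
    by (simp add: A_def B_def oriented_def path_gf_fresh power2_eq_square algebra_simps split: if_splits)
qed

text \<open>The kernel equation for a vertical side. Among the functions that are geometric in the
depth \<open>h\<close>, with ratio \<open>z\<close>, the condition that \<open>F - t \<Delta>F\<close> vanishes below the top row fixes the
values in the three phases up to a common factor; there is a nonzero solution because \<open>z\<close>
satisfies the assumption. The potential is continued to the top row so that what remains are the
walks ending at the corner and the walks in state \<open>Fresh\<close>, the latter weighted as if they went
on to that corner.\<close>

lemma path_gf_corner:
  fixes v z :: "'a::field_char_0 fps"
  assumes z: "(z - fps_X) * (1 - fps_X * z) = fps_X * v * z * (1 - fps_X^2)"
  shows "(1 - fps_X * z - fps_X * v) * path_gf (corner_weight d v)
       = fps_X * v * (1 + fps_X * (1 - fps_X * z) * path_gf (oriented d top_weight (fps_X * v) v))"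
proof -
  let ?t = "fps_X :: 'a fps"
  define G where "G = (\<lambda>s. case s of
      Column h \<Rightarrow> ?t * v * z ^ h
    | Fresh i j \<Rightarrow> 0
    | Along b i j \<Rightarrow> if b = d then ?t * v * (1 - ?t * z) * (?t * v) ^ i * v ^ j else 0
    | Flank b p h m \<Rightarrow> if b \<noteq> d then 0 else (case p of
          Outward \<Rightarrow> v ^ m * z ^ h * (1 - ?t * z)
        | Upward \<Rightarrow> v ^ m * z ^ h * (1 - ?t * z - ?t^2 * v * z)
        | Downward \<Rightarrow> ?t * v * v ^ m * z ^ Suc h))"
  define A where "A = oriented d fresh_weight (fps_X * v) v"
  have "path_gf (\<lambda>s. (1 - fps_X * z - fps_X * v) * corner_weight d v s
      + (- (fps_X * v * (1 - fps_X * z))) * A s) = G (Column 0)"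
  proof (rule path_gf_potential)
    fix s
    \<comment> \<open>The assumption on \<open>z\<close>, multiplied out and arranged as a rewrite rule for the monomials that occur.\<close>
    have z': "?t * (v ^ m * z ^ h) + (?t * (v * (z * (v ^ m * z ^ h))) + ?t * (z * (z * (v ^ m * z ^ h))))
      = z * (v ^ m * z ^ h) + (?t * (?t * (z * (v ^ m * z ^ h)))
        + ?t * (?t * (?t * (v * (z * (v ^ m * z ^ h))))))" for m h
      using arg_cong [OF z, of "\<lambda>e. v ^ m * z ^ h * e"] by (simp add: algebra_simps power2_eq_square)
    show "(1 - fps_X * z - fps_X * v) * corner_weight d v s
      + (- (fps_X * v * (1 - fps_X * z))) * A s = G s - fps_X * next_sum G s"
      by (cases "(s, West)" rule: move.cases)
         (auto simp: next_sum_simps G_def A_def oriented_def slide_def climb_def fresh_def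
           power_mult_distrib algebra_simps power2_eq_square z' split: nat.splits)
  qed
  hence "(1 - fps_X * z - fps_X * v) * path_gf (corner_weight d v)
      = fps_X * v + fps_X * v * (1 - fps_X * z) * path_gf A"
    unfolding path_gf_add path_gf_mult by (simp add: G_def algebra_simps)
  thus ?thesis
    by (simp add: A_def oriented_def path_gf_fresh power2_eq_square algebra_simps split: if_splits)
qed

text \<open>The analogue for \<open>z = 1\<close>, where the potential does not depend on the depth. Since \<open>z = 1\<close>
does not satisfy the kernel equation, the states below the top row do not cancel: they keep the
first factor on the left, and the walks at the corner need a correction. The states \<open>Column h\<close>
join them as sides of width \<open>0\<close>, with \<open>Column 0\<close> as the start.\<close>

lemma path_gf_flank:
  fixes v :: "'a::field_char_0 fps"
  shows "(1 - fps_X - fps_X * v - fps_X^2 * v)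
          * (path_gf (flank_weight d v) + path_gf column_weight)
          + fps_X * path_gf (corner_weight d v)
       = 1 + fps_X^2 * v * (1 + fps_X) * path_gf (oriented d top_weight (fps_X * v) v)"
proof -
  let ?t = "fps_X :: 'a fps"
  define G where "G = (\<lambda>s. case s of
      Column h \<Rightarrow> 1
    | Fresh i j \<Rightarrow> 0
    | Along b i j \<Rightarrow> if b = d then ?t * v * (1 + ?t) * (?t * v) ^ i * v ^ j else 0
    | Flank b p h m \<Rightarrow> if b \<noteq> d then 0 else if p = Outward then (1 + ?t) * v ^ m else v ^ m)"
  define A where "A = oriented d fresh_weight (fps_X * v) v"
  have "path_gf (\<lambda>s. (1 - fps_X - fps_X * v - fps_X^2 * v) * (flank_weight d v s + column_weight s)
      + (fps_X * corner_weight d v s + (- (fps_X * v * (1 + fps_X))) * A s)) = G (Column 0)"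
  proof (rule path_gf_potential)
    fix s
    show "(1 - fps_X - fps_X * v - fps_X^2 * v) * (flank_weight d v s + column_weight s)
      + (fps_X * corner_weight d v s + (- (fps_X * v * (1 + fps_X))) * A s) = G s - fps_X * next_sum G s"
      by (cases "(s, West)" rule: move.cases)
         (auto simp: next_sum_simps G_def A_def oriented_def slide_def climb_def fresh_def
           power_mult_distrib algebra_simps power2_eq_square split: nat.splits)
  qed
  hence "(1 - fps_X - fps_X * v - fps_X^2 * v)
          * (path_gf (flank_weight d v) + path_gf column_weight)
          + fps_X * path_gf (corner_weight d v) = 1 + fps_X * v * (1 + fps_X) * path_gf A"
    unfolding path_gf_add path_gf_mult by (simp add: G_def algebra_simps)
  thus ?thesis
    by (simp add: A_def oriented_def path_gf_fresh power2_eq_square algebra_simps split: if_splits)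
qed

lemma top_weight_split:
  "top_weight x y s = start_weight s + (fresh_weight x y s
     + (along_weight True x y s + (along_weight False y x s
     + (corner_weight True y s + corner_weight False x s))))"
  by (cases s) (auto simp: top_weight_def)

lemma path_gf_top:
  "path_gf (top_weight x y) = 1 + fps_X * path_gf (top_weight x y)
     + path_gf (along_weight True x y) + path_gf (along_weight False y x)
     + path_gf (corner_weight True y) + path_gf (corner_weight False x)"
proof -
  have "top_weight x y = (\<lambda>s. start_weight s + (fresh_weight x y s
     + (along_weight True x y s + (along_weight False y x s
     + (corner_weight True y s + corner_weight False x s)))))"
    using top_weight_split by blast
  hence "path_gf (top_weight x y) = 1 + (path_gf (fresh_weight x y)
     + (path_gf (along_weight True x y) + (path_gf (along_weight False y x)
     + (path_gf (corner_weight True y) + path_gf (corner_weight False x)))))"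
    by (simp only: path_gf_add path_gf_start)
  thus ?thesis by (simp add: path_gf_fresh add_ac)
qed

lemma path_gf_top_mirror: "path_gf (top_weight x y) = path_gf (top_weight y x)"
proof -
  have "top_weight x y (mirror s) = top_weight y x s" for s
    by (cases s) (auto simp: top_weight_def)
  thus ?thesis using path_gf_mirror [of "top_weight x y"] by simp
qed

text \<open>Walks end on the top row, or below it on one of the two sides, or below it in a column.
The last term removes the empty walk, which is counted by both the first and the last of the
preceding terms.\<close>

lemma path_gf_width:
  "path_gf (\<lambda>s. u ^ width s) = path_gf (top_weight u u)
     + (path_gf (flank_weight True u) - path_gf (corner_weight True u))
     + (path_gf (flank_weight False u) - path_gf (corner_weight False u))
     + path_gf column_weight - 1"
proof -
  have "u ^ width s + (corner_weight True u s + (corner_weight False u s + start_weight s))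
    = top_weight u u s + (flank_weight True u s + (flank_weight False u s + column_weight s))" for s
    by (cases s) (auto simp: top_weight_def power_add mult.commute)
  hence "path_gf (\<lambda>s. u ^ width s + (corner_weight True u s + (corner_weight False u s + start_weight s)))
    = path_gf (\<lambda>s. top_weight u u s + (flank_weight True u s + (flank_weight False u s + column_weight s)))"
    by simp
  thus ?thesis unfolding path_gf_add path_gf_start by (simp add: algebra_simps)
qed

lemma T_gf_eq_path_gf: "T_gf u v = path_gf (top_weight u v)"
  unfolding T_gf_def by (rule suminf_walks) (simp add: run_statistics top_weight_def)

lemma P_gf_eq_path_gf: "P_gf u = path_gf (\<lambda>st. u ^ width st)"
  using suminf_walks [of "\<lambda>st. u ^ width st" "\<lambda>_. True" "\<lambda>w. u ^ box_width w"]
  by (simp add: P_gf_def run_statistics)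

section \<open>The series U and q\<close>

lemma fps_sqrt1_power2:
  fixes S :: "'a::field_char_0 fps"
  assumes "S $ 0 = 1"
  shows "(fps_sqrt1 S)^2 = S"
  using assms power_radical [of S "\<lambda>_ _. 1" 1] by (simp add: fps_sqrt1_def numeral_2_eq_2)

lemma fps_X_dvd: "f $ 0 = 0 \<Longrightarrow> fps_X dvd (f :: 'a::comm_ring_1 fps)"
  by (rule dvdI [of _ _ "fps_shift 1 f"]) (simp add: fps_eq_iff)

lemma U_ser_quadratic:
  fixes w :: "'a::field_char_0 fps"
  shows "(U_ser w - fps_X) * (1 - fps_X * U_ser w) = fps_X * w * U_ser w * (1 - fps_X^2)"
proof -
  let ?t = "fps_X :: 'a fps"
  \<comment> \<open>The root is a solution since \<open>S = b\<^sup>2 - 4 t\<^sup>2\<close>, the discriminant of \<open>t V\<^sup>2 - b V + t\<close>.\<close>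
  define S where "S = (1 - ?t^2) * (1 + ?t - ?t * w + ?t^2 * w) * (1 - ?t - ?t * w - ?t^2 * w)"
  define b where "b = 1 - ?t * w + ?t^2 + ?t^3 * w"
  have S: "(fps_sqrt1 S)^2 = S" by (rule fps_sqrt1_power2) (simp add: S_def)
  have U: "U_ser w = (b - fps_sqrt1 S) / (2 * ?t)"
    by (simp add: U_ser_def Let_def S_def b_def)
  have "(b - fps_sqrt1 S) $ 0 = 0"
    by (simp add: b_def fps_sqrt1_def)
  hence "?t dvd b - fps_sqrt1 S"
    by (rule fps_X_dvd)
  moreover have "2 * fps_const (1 / 2) = (1 :: 'a fps)"
    by (simp add: numeral_fps_const)
  hence "2 * ?t dvd ?t"
    by (intro dvdI [of _ _ "fps_const (1 / 2)"]) algebra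
  ultimately have "2 * ?t dvd b - fps_sqrt1 S"
    using dvd_trans by blast
  hence "2 * ?t * U_ser w = b - fps_sqrt1 S"
    unfolding U by simp
  hence "(b - 2 * ?t * U_ser w)^2 = S"
    using S by simp
  hence "(4 * ?t) * ((U_ser w - fps_X) * (1 - fps_X * U_ser w))
      = (4 * ?t) * (fps_X * w * U_ser w * (1 - fps_X^2))"
    unfolding S_def b_def by algebra
  thus ?thesis by simp
qed

text \<open>The difference of two solutions is annihilated by a series with constant coefficient \<open>1\<close>.
The two roots of the quadratic equation have product \<open>1\<close>, and since one of them vanishes at \<open>t =
0\<close>, the other has a pole there.\<close>

lemma U_ser_unique:
  fixes V w :: "'a::field_char_0 fps"
  assumes V: "(V - fps_X) * (1 - fps_X * V) = fps_X * w * V * (1 - fps_X^2)"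
  shows "V = U_ser w"
proof -
  let ?t = "fps_X :: 'a fps"
  have "(V - U_ser w) * (1 + ?t^2 - ?t * w * (1 - ?t^2) - ?t * (V + U_ser w)) = 0"
    using V U_ser_quadratic [of w] by algebra
  moreover have "(1 + ?t^2 - ?t * w * (1 - ?t^2) - ?t * (V + U_ser w)) $ 0 \<noteq> 0"
    by simp
  hence "1 + ?t^2 - ?t * w * (1 - ?t^2) - ?t * (V + U_ser w) \<noteq> 0"
    by fastforce
  ultimately show ?thesis by simp
qed

lemma U_ser_nth_0 [simp]: "U_ser w $ 0 = 0"
  using arg_cong [OF U_ser_quadratic [of w], of "\<lambda>f. f $ 0"] by simp

text \<open>The generating function of the walks that end at a given corner, up to the part that is
proportional to \<open>T(w, tw)\<close>; see \<open>corner_gf\<close>.\<close>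

definition U_ratio :: "'a::field_char_0 fps \<Rightarrow> 'a fps" where
  "U_ratio w = (U_ser w - fps_X) / (fps_X * (1 - fps_X * U_ser w))"

text \<open>By the quadratic equation the numerator is divisible by \<open>t\<close> times a unit, so that the
division is exact.\<close>

lemma U_ratio:
  fixes w :: "'a::field_char_0 fps"
  shows "fps_X * (1 - fps_X * U_ser w) * U_ratio w = U_ser w - fps_X"
proof -
  let ?V = "1 - fps_X * U_ser w"
  have "?V * inverse ?V = 1"
    by (rule inverse_mult_eq_1') simp
  hence "U_ser w - fps_X = fps_X * ?V * (w * U_ser w * (1 - fps_X^2) * inverse ?V * inverse ?V)"
    using U_ser_quadratic [of w] by algebra
  hence "fps_X * ?V dvd U_ser w - fps_X"
    by (metis dvdI)
  thus ?thesis
    by (simp add: U_ratio_def)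
qed

lemma q_ser_quadratic:
  "(q_ser - fps_X) * (1 - fps_X * q_ser) = fps_X * q_ser * (1 - fps_X^2 :: 'a::field_char_0 fps)"
  using U_ser_quadratic [of 1] by (simp add: q_ser_def)

lemma q_ser_nth_0 [simp]: "q_ser $ 0 = 0"
  by (simp add: q_ser_def)

lemma q_ser_neq_X: "q_ser \<noteq> (fps_X :: 'a::field_char_0 fps)"
proof
  assume "q_ser = (fps_X :: 'a fps)"
  hence "fps_X * fps_X * (1 - fps_X^2 :: 'a fps) = 0"
    using q_ser_quadratic [where ?'a = 'a] by simp
  moreover have "(1 - fps_X^2 :: 'a fps) $ 0 \<noteq> 0" by simp
  hence "(1 - fps_X^2 :: 'a fps) \<noteq> 0" by fastforce
  ultimately show False by simp
qed

text \<open>Numerator and denominator are both divisible by \<open>t\<^sup>2\<close>; the quadratic equation for \<open>q\<close>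
exhibits the quotient as a unit.\<close>

lemma q_ser_ratio:
  "fps_X * q_ser / (q_ser - fps_X) = (1 - fps_X * q_ser) * inverse (1 - fps_X^2 :: 'a::field_char_0 fps)"
proof -
  have "(1 - fps_X^2) * inverse (1 - fps_X^2) = (1 :: 'a fps)"
    by (rule inverse_mult_eq_1') simp
  hence "fps_X * q_ser = (1 - fps_X * q_ser) * inverse (1 - fps_X^2) * (q_ser - fps_X :: 'a fps)"
    using q_ser_quadratic [where ?'a = 'a] by algebra
  thus ?thesis
    using q_ser_neq_X [where ?'a = 'a] by (metis nonzero_mult_div_cancel_right eq_iff_diff_eq_0)
qed

lemma q_ser_closed_form:
  "q_ser = (1 - fps_X + fps_X^2 + fps_X^3
      - fps_sqrt1 ((1 - fps_X^4) * (1 - 2 * fps_X - fps_X^2))) / (2 * fps_X :: 'a::field_char_0 fps)"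
proof -
  have "(1 - fps_X^2) * (1 + fps_X - fps_X * 1 + fps_X^2 * 1) * (1 - fps_X - fps_X * 1 - fps_X^2 * 1)
      = (1 - fps_X^4) * (1 - 2 * fps_X - fps_X^2 :: 'a fps)"
    by algebra
  thus ?thesis unfolding q_ser_def U_ser_def Let_def by (simp only: mult_1_right)
qed

section \<open>Specializing to the roots of the kernels\<close>

text \<open>The choice \<open>z = U(v)\<close> solves the kernel equation of a side. The factors cancelled are \<open>t\<close>
and units, and the right-hand side takes the same form for both corners because \<open>T\<close> is
symmetric.\<close>

lemma corner_gf:
  fixes v :: "'a::field_char_0 fps"
  shows "path_gf (corner_weight d v)
       = U_ratio v + (U_ser v - fps_X) * path_gf (top_weight v (fps_X * v))"
proof -
  define z where "z = U_ser v"
  define k where "k = 1 - fps_X * z - fps_X * v"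
  define P where "P = path_gf (top_weight v (fps_X * v))"
  define c where "c = path_gf (corner_weight d v)"
  have z: "(z - fps_X) * (1 - fps_X * z) = fps_X * v * z * (1 - fps_X^2)"
    unfolding z_def by (rule U_ser_quadratic)
  have c: "k * c = fps_X * v * (1 + fps_X * (1 - fps_X * z) * P)"
    using path_gf_corner [OF z, of d] path_gf_top_mirror [of "fps_X * v" v]
    by (cases d) (simp_all add: k_def P_def c_def oriented_def)
  have kz: "k * (z - fps_X) = fps_X^2 * v * (1 - fps_X * z)"
    using z unfolding k_def by algebra
  have r: "fps_X * (1 - fps_X * z) * U_ratio v = z - fps_X"
    using U_ratio [of v] by (simp add: z_def)
  have "(k * (fps_X * (1 - fps_X * z))) * c
      = (k * (fps_X * (1 - fps_X * z))) * (U_ratio v + (z - fps_X) * P)"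
    using c kz r by algebra
  moreover have "k $ 0 \<noteq> 0" "(1 - fps_X * z) $ 0 \<noteq> 0"
    by (simp_all add: k_def)
  hence "k \<noteq> 0" "1 - fps_X * z \<noteq> 0"
    by fastforce+
  ultimately show ?thesis
    by (simp add: c_def P_def z_def)
qed

text \<open>The equation for \<open>T(u, v)\<close> at \<open>v = uq\<close>. Multiplied by \<open>(1 - tq)(q - t)\<close>, the coefficient
of the unknown \<open>T(u, uq)\<close> is \<open>(1 - tq)(q - t) - tq(1 - t\<^sup>2)\<close>, which vanishes because \<open>q = U(1)\<close>.
This leaves \<open>T(u, tu)\<close> and \<open>T(tuq, uq)\<close>, and the latter is \<open>T(uq, tuq)\<close> by symmetry.\<close>

lemma kernel_step:
  fixes u :: "'a::field_char_0 fps"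
  defines "\<Phi> \<equiv> \<lambda>v. path_gf (top_weight v (fps_X * v))"
  shows "(fps_X * q_ser / (q_ser - fps_X) - U_ser u) * \<Phi> u
       + (fps_X / (1 - fps_X * q_ser) - U_ser (u * q_ser)) * \<Phi> (u * q_ser)
       = 1 + U_ratio u + U_ratio (u * q_ser)"
proof -
  let ?t = "fps_X :: 'a fps"
  define q where "q = (q_ser :: 'a fps)"
  define \<alpha> where "\<alpha> = ?t * q / (q - ?t)"
  define \<beta> where "\<beta> = ?t / (1 - ?t * q)"
  have q: "(q - ?t) * (1 - ?t * q) = ?t * q * (1 - ?t^2)"
    unfolding q_def by (rule q_ser_quadratic)
  have inv: "(1 - ?t^2) * inverse (1 - ?t^2) = 1"
    by (rule inverse_mult_eq_1') simp
  have \<alpha>: "\<alpha> * (q - ?t) = ?t * q"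
    using q inv unfolding \<alpha>_def q_def q_ser_ratio by algebra
  have unit: "(1 - ?t * q) $ 0 \<noteq> 0"
    by (simp add: q_def)
  have \<beta>: "\<beta> * (1 - ?t * q) = ?t"
    unfolding \<beta>_def using unit by (intro dvd_div_mult_self) (rule fps_unit_dvd)
  define T where "T = path_gf (top_weight u (u * q))"
  define E where "E = path_gf (along_weight True u (u * q))"
  define W where "W = path_gf (along_weight False (u * q) u)"
  define C where "C = path_gf (corner_weight False u)"
  define C' where "C' = path_gf (corner_weight True (u * q))"
  have T: "T = 1 + ?t * T + E + W + C' + C"
    unfolding T_def E_def W_def C_def C'_def by (rule path_gf_top)
  have E: "(1 - ?t * q) * E = ?t^2 * q * (T - \<Phi> (u * q))"
    using path_gf_along [of 1 q True u] path_gf_top_mirror [of "?t * (u * q)" "u * q"]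
    by (simp add: T_def E_def \<Phi>_def oriented_def mult_ac)
  have W: "(q - ?t) * W = ?t^2 * (T - \<Phi> u)"
    using path_gf_along [of q 1 False u]
    by (simp add: T_def W_def \<Phi>_def oriented_def mult_ac)
  have C: "C = U_ratio u + (U_ser u - ?t) * \<Phi> u"
    unfolding C_def \<Phi>_def by (rule corner_gf)
  have C': "C' = U_ratio (u * q) + (U_ser (u * q) - ?t) * \<Phi> (u * q)"
    unfolding C'_def \<Phi>_def by (rule corner_gf)
  have "(1 - ?t * q) * (q - ?t) * (1 + C + C')
      = ?t^2 * q * (q - ?t) * \<Phi> (u * q) + ?t^2 * (1 - ?t * q) * \<Phi> u"
    using T E W q by algebra
  hence "((1 - ?t * q) * (q - ?t)) * ((\<alpha> - U_ser u) * \<Phi> u + (\<beta> - U_ser (u * q)) * \<Phi> (u * q))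
      = ((1 - ?t * q) * (q - ?t)) * (1 + U_ratio u + U_ratio (u * q))"
    using \<alpha> \<beta> C C' by algebra
  moreover have "1 - ?t * q \<noteq> 0" "q - ?t \<noteq> 0"
    using unit q_ser_neq_X by (fastforce, simp add: q_def)
  ultimately show ?thesis
    by (simp add: \<alpha>_def \<beta>_def q_def)
qed

text \<open>Solving each relation for \<open>\<Phi> k\<close> and substituting the next one gives a partial sum and a
remainder that contains the product of the first coefficients \<open>N i\<close>. Each of them is divisible
by \<open>t\<close>, so that the remainder tends to \<open>0\<close>.\<close>

lemma iterate_to_sums:
  fixes \<Phi> B D N :: "nat \<Rightarrow> 'a::field_char_0 fps"
  assumes step: "\<And>k. D k * \<Phi> k + N k * \<Phi> (Suc k) = B k"
    and D: "\<And>k. D k $ 0 \<noteq> 0" and N: "\<And>k. N k $ 0 = 0"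
  shows "(\<lambda>k. (-1) ^ k * ((\<Prod>i<k. N i) / (\<Prod>i\<le>k. D i)) * B k) sums \<Phi> 0"
proof -
  define J where "J = (\<lambda>k. inverse (D k))"
  have J: "J k * D k = 1" for k
    unfolding J_def using D by (rule inverse_mult_eq_1)
  have div: "a / (\<Prod>i\<le>k. D i) = a * (\<Prod>i\<le>k. J i)" for a k
  proof -
    have "(\<Prod>i\<le>k. D i) $ 0 \<noteq> 0" 
      using D by (induction k) simp_all
    moreover have "(\<Prod>i\<le>k. J i) * (\<Prod>i\<le>k. D i) = 1"
      by (simp add: J flip: prod.distrib)
    ultimately show ?thesis
      by (metis fps_divide_unit fps_inverse_unique mult.commute)
  qed
  have partial: "(\<Sum>k<n. (-1) ^ k * ((\<Prod>i<k. N i) * (\<Prod>i\<le>k. J i)) * B k)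
      = \<Phi> 0 - (\<Prod>i<n. - N i) * ((\<Prod>i<n. J i) * \<Phi> n)" for n
  proof (induction n)
    case (Suc n)
    have "J n * B n = (J n * D n) * \<Phi> n + J n * N n * \<Phi> (Suc n)"
      unfolding step [of n, symmetric] by (simp add: algebra_simps)
    hence "J n * B n = \<Phi> n + J n * N n * \<Phi> (Suc n)"
      by (simp add: J)
    hence "(-1) ^ n * (\<Prod>i<n. N i) * (\<Prod>i<n. J i) * (J n * B n)
        = (-1) ^ n * (\<Prod>i<n. N i) * (\<Prod>i<n. J i) * (\<Phi> n + J n * N n * \<Phi> (Suc n))"
      by simp
    moreover have "(\<Prod>i<n. - N i) = (-1) ^ n * (\<Prod>i<n. N i)"
      by (simp add: prod_uminus)
    ultimately show ?case
      using Suc by (simp add: algebra_simps flip: lessThan_Suc_atMost)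
  qed simp
  have rest: "((\<Prod>i<n. - N i) * c) $ j = 0" if "j < n" for j n c
  proof -
    have "fps_X ^ n dvd (\<Prod>i<n. - N i)" 
    proof (induction n)
      case (Suc n)
      have "fps_X dvd - N n"
        using N [of n] by (simp add: fps_X_dvd)
      thus ?case using Suc mult_dvd_mono by fastforce
    qed simp
    then obtain d where "(\<Prod>i<n. - N i) = fps_X ^ n * d" by blast
    thus ?thesis using that by (simp add: mult.assoc fps_X_power_mult_nth)
  qed
  have "(\<lambda>n. \<Sum>k<n. (-1) ^ k * ((\<Prod>i<k. N i) * (\<Prod>i\<le>k. J i)) * B k) \<longlonglongrightarrow> \<Phi> 0"
  proof (rule tendsto_fpsI)
    fix j
    show "eventually (\<lambda>n. (\<Sum>k<n. (-1) ^ k * ((\<Prod>i<k. N i) * (\<Prod>i\<le>k. J i)) * B k) $ j = \<Phi> 0 $ j)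
        sequentially"
      unfolding partial by (intro eventually_sequentiallyI [of "Suc j"]) (simp add: rest)
  qed
  thus ?thesis by (simp add: sums_def div)
qed

lemma top_gf_sums:
  fixes u :: "'a::field_char_0 fps"
  shows "(\<lambda>k. (-1) ^ k *
        ((\<Prod>i<k. fps_X / (1 - fps_X * q_ser) - U_ser (u * q_ser ^ (i + 1))) /
         (\<Prod>i\<le>k. fps_X * q_ser / (q_ser - fps_X) - U_ser (u * q_ser ^ i))) *
        (1 + U_ratio (u * q_ser ^ k) + U_ratio (u * q_ser ^ (k + 1))))
      sums path_gf (top_weight u (fps_X * u))"
proof -
  let ?\<Phi> = "\<lambda>k. path_gf (top_weight (u * q_ser ^ k) (fps_X * (u * q_ser ^ k)))"
  have "(\<lambda>k. (-1) ^ k *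
        ((\<Prod>i<k. fps_X / (1 - fps_X * q_ser) - U_ser (u * q_ser ^ (i + 1))) /
         (\<Prod>i\<le>k. fps_X * q_ser / (q_ser - fps_X) - U_ser (u * q_ser ^ i))) *
        (1 + U_ratio (u * q_ser ^ k) + U_ratio (u * q_ser ^ (k + 1))))
      sums ?\<Phi> 0"
  proof (rule iterate_to_sums)
    fix k
    show "(fps_X * q_ser / (q_ser - fps_X) - U_ser (u * q_ser ^ k)) * ?\<Phi> k
        + (fps_X / (1 - fps_X * q_ser) - U_ser (u * q_ser ^ (k + 1))) * ?\<Phi> (Suc k)
        = 1 + U_ratio (u * q_ser ^ k) + U_ratio (u * q_ser ^ (k + 1))"
      using kernel_step [of "u * q_ser ^ k"] by (simp add: mult_ac)
    show "(fps_X * q_ser / (q_ser - fps_X) - U_ser (u * q_ser ^ k)) $ 0 \<noteq> 0"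
      by (simp add: q_ser_ratio)
    show "(fps_X / (1 - fps_X * q_ser) - U_ser (u * q_ser ^ (k + 1))) $ 0 = 0"
      by (simp add: fps_divide_unit)
  qed
  thus ?thesis by simp
qed

text \<open>The variables are equal here, so that the kernel of the top row takes the value \<open>(1 - 2t -
t\<^sup>2) / (1 - t)\<close>, which explains the first denominator; the second one comes from the sides.\<close>

lemma width_gf:
  fixes u :: "'a::field_char_0 fps"
  defines "\<Phi> \<equiv> path_gf (top_weight u (fps_X * u))"
  shows "path_gf (\<lambda>s. u ^ width s) =
      1 / (1 - 2 * fps_X - fps_X^2) *
        (2 * fps_X^2 * U_ser u * \<Phi> + (1 + fps_X) * (2 - fps_X - fps_X^2 * U_ser u) / (1 - fps_X * U_ser u))
      - 2 * (1 - U_ser u) * (1 + fps_X) * (1 - u)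
          / ((1 - 2 * fps_X - fps_X^2) * (1 - fps_X - fps_X * u - fps_X^2 * u)) *
        (fps_X^2 * \<Phi> + (1 + fps_X) * fps_X / (1 - fps_X * U_ser u))
      - 1 / (1 - fps_X)"
proof -
  let ?t = "fps_X :: 'a fps"
  define z where "z = U_ser u"
  define M where "M = 1 - 2 * ?t - ?t^2"
  define c where "c = 1 - ?t - ?t * u - ?t^2 * u"
  define y where "y = 1 - ?t * z"
  define T where "T = path_gf (top_weight u u)"
  define E where "E = (\<lambda>d. path_gf (along_weight d u u))"
  define C where "C = U_ratio u + (z - ?t) * \<Phi>"
  define R where "R = (\<lambda>d. path_gf (flank_weight d u))"
  define K where "K = (path_gf column_weight :: 'a fps)"
  define P where "P = path_gf (\<lambda>s. u ^ width s)"
  have z: "(z - ?t) * (1 - ?t * z) = ?t * u * z * (1 - ?t^2)"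
    unfolding z_def by (rule U_ser_quadratic)
  have mir: "path_gf (top_weight (?t * u) u) = \<Phi>"
    unfolding \<Phi>_def by (rule path_gf_top_mirror)
  have corner: "path_gf (corner_weight d u) = C" for d
    unfolding C_def \<Phi>_def z_def by (rule corner_gf)
  have T: "T = 1 + ?t * T + E True + E False + C + C"
    using path_gf_top [of u u] by (simp add: T_def E_def corner)
  have E: "(1 - ?t) * E d = ?t^2 * (T - \<Phi>)" for d
    using path_gf_along [of 1 1 d u] mir by (cases d) (simp_all add: T_def E_def \<Phi>_def oriented_def mult_ac)
  have MT: "M * T = (1 - ?t) * (1 + 2 * C) - 2 * ?t^2 * \<Phi>"
    using T E [of True] E [of False] unfolding M_def by algebra
  have cR: "c * (R d + K) + ?t * C = 1 + ?t^2 * u * (1 + ?t) * \<Phi>" for d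
    using path_gf_flank [of u d] mir
    by (cases d) (simp_all add: c_def R_def K_def corner \<Phi>_def oriented_def)
  have K: "(1 - ?t) * K = 1"
    unfolding K_def by (rule path_gf_column)
  have P: "P = T + (R True - C) + (R False - C) + K - 1"
    unfolding P_def T_def R_def K_def path_gf_width by (simp add: corner)
  have C: "?t * y * C = (z - ?t) * (1 + ?t * y * \<Phi>)"
    using U_ratio [of u] unfolding C_def y_def z_def by algebra
  have units: "M $ 0 \<noteq> 0" "c $ 0 \<noteq> 0" "y $ 0 \<noteq> 0" "(1 - ?t) $ 0 \<noteq> 0"
    by (simp_all add: M_def c_def y_def)
  have nz: "M \<noteq> 0" "c \<noteq> 0" "y \<noteq> 0"
    using units by auto
  have unit_div: "b * (a / b) = a" if "b $ 0 \<noteq> 0" for a b :: "'a fps"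
    using that by (intro dvd_mult_div_cancel) (rule fps_unit_dvd)
  have K': "1 / (1 - ?t) = K"
    using K unit_div [OF units(4), of 1] by (metis mult_left_cancel mult_zero_left zero_neq_one)
  define iM where "iM = 1 / M"
  define a1 where "a1 = (1 + ?t) * (2 - ?t - ?t^2 * z) / y"
  define a2 where "a2 = 2 * (1 - z) * (1 + ?t) * (1 - u) / (M * c)"
  define a3 where "a3 = (1 + ?t) * ?t / y"
  have d: "M * iM = 1" "y * a1 = (1 + ?t) * (2 - ?t - ?t^2 * z)"
     "M * c * a2 = 2 * (1 - z) * (1 + ?t) * (1 - u)" "y * a3 = (1 + ?t) * ?t"
    unfolding iM_def a1_def a2_def a3_def using units by (simp_all add: unit_div)
  \<comment> \<open>Clear denominators; the factor \<open>t\<close> makes the equation \<open>C\<close> for the corners applicable.\<close>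
  have "(M * c * (?t * y)) * P = (M * c * (?t * y)) * (iM * (2 * ?t^2 * z * \<Phi> + a1) - a2 * (?t^2 * \<Phi> + a3) - K)"
  proof -
    have "M * c * (?t * y) * (P + K) = c * (?t * y) * (M * T) + (?t * y) * M * (c * (R True + K) + c * (R False + K))
       - 2 * M * c * (?t * y * C) - M * c * (?t * y)"
      unfolding P by algebra
    also have "\<dots> = c * (?t * y) * ((1 - ?t) - 2 * ?t^2 * \<Phi>) + 2 * (?t * y) * M * (1 + ?t^2 * u * (1 + ?t) * \<Phi>)
       - M * c * (?t * y) + (2 * c * (1 - ?t) - 2 * M * ?t - 2 * M * c) * (?t * y * C)"
      using MT cR [of True] cR [of False] by algebra
    also have "\<dots> = ?t * c * (y * (2 * ?t^2 * z * \<Phi>) + (1 + ?t) * (2 - ?t - ?t^2 * z))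
       - ?t * (2 * (1 - z) * (1 + ?t) * (1 - u)) * (y * ?t^2 * \<Phi> + (1 + ?t) * ?t)"
      using C z unfolding c_def M_def y_def by algebra
    also have "\<dots> = (M * c * (?t * y)) * (iM * (2 * ?t^2 * z * \<Phi> + a1) - a2 * (?t^2 * \<Phi> + a3))"
      using d by algebra
    finally show ?thesis by (simp add: algebra_simps)
  qed
  hence "P = iM * (2 * ?t^2 * z * \<Phi> + a1) - a2 * (?t^2 * \<Phi> + a3) - K"
    using nz by simp
  thus ?thesis
    by (simp add: P_def iM_def a1_def a2_def a3_def z_def K' [symmetric] M_def c_def y_def)
qed

theorem proposition7:
  fixes u :: "'a::field_char_0 fps"
  shows "let t = (fps_X :: 'a fps); q = (q_ser :: 'a fps); U = (U_ser :: 'a fps \<Rightarrow> 'a fps);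
             T = (T_gf :: 'a fps \<Rightarrow> 'a fps \<Rightarrow> 'a fps); P = (P_gf :: 'a fps \<Rightarrow> 'a fps) in
    (\<forall>w V. (V - t) * (1 - t * V) = t * w * V * (1 - t^2) \<longleftrightarrow> V = U w) \<and>
    q = (1 - t + t^2 + t^3 - fps_sqrt1 ((1 - t^4) * (1 - 2 * t - t^2))) / (2 * t) \<and>
    (\<lambda>k. (-1) ^ k *
        ((\<Prod>i<k. t / (1 - t * q) - U (u * q ^ (i + 1))) /
         (\<Prod>i\<le>k. t * q / (q - t) - U (u * q ^ i))) *
        (1 + (U (u * q ^ k) - t) / (t * (1 - t * U (u * q ^ k)))
           + (U (u * q ^ (k + 1)) - t) / (t * (1 - t * U (u * q ^ (k + 1))))))
      sums T u (t * u) \<and>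
    P u =
      1 / (1 - 2 * t - t^2) *
        (2 * t^2 * U u * T u (t * u) + (1 + t) * (2 - t - t^2 * U u) / (1 - t * U u))
      - 2 * (1 - U u) * (1 + t) * (1 - u) / ((1 - 2 * t - t^2) * (1 - t - t * u - t^2 * u)) *
        (t^2 * T u (t * u) + (1 + t) * t / (1 - t * U u))
      - 1 / (1 - t) \<and>
    P 1 =
      1 / (1 - 2 * t - t^2) *
        (2 * t^2 * q * T 1 t + (1 + t) * (2 - t - t^2 * q) / (1 - t * q))
      - 1 / (1 - t)"
  unfolding Let_def T_gf_eq_path_gf P_gf_eq_path_gf
proof (intro conjI)
  show "\<forall>w V. (V - fps_X) * (1 - fps_X * V) = fps_X * w * V * (1 - fps_X^2)
      \<longleftrightarrow> V = (U_ser w :: 'a fps)"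
    using U_ser_unique U_ser_quadratic by blast
next
  show "(\<lambda>k. (-1) ^ k *
        ((\<Prod>i<k. fps_X / (1 - fps_X * q_ser) - U_ser (u * q_ser ^ (i + 1))) /
         (\<Prod>i\<le>k. fps_X * q_ser / (q_ser - fps_X) - U_ser (u * q_ser ^ i))) *
        (1 + (U_ser (u * q_ser ^ k) - fps_X) / (fps_X * (1 - fps_X * U_ser (u * q_ser ^ k)))
           + (U_ser (u * q_ser ^ (k + 1)) - fps_X) / (fps_X * (1 - fps_X * U_ser (u * q_ser ^ (k + 1))))))
      sums path_gf (top_weight u (fps_X * u))"
    using top_gf_sums [of u] unfolding U_ratio_def .
next
  show "path_gf (\<lambda>st. 1 ^ width st) = 1 / (1 - 2 * fps_X - fps_X^2) *
        (2 * fps_X^2 * q_ser * path_gf (top_weight 1 fps_X)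
          + (1 + fps_X) * (2 - fps_X - fps_X^2 * q_ser) / (1 - fps_X * q_ser))
      - 1 / (1 - fps_X :: 'a fps)"
    using width_gf [of "1 :: 'a fps"] by (simp add: q_ser_def)
qed (rule q_ser_closed_form, rule width_gf)

end
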